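(* Let $\Sigma\in\mathbb{R}^{\mathtt w\times\mathtt w}$ be nonsingular, symmetric and indefinite. Then there exists $\mathfrak{B}\in\mathfrak{L}^{\mathtt w}$ for which the following holds: (P) there exist controllable behaviors $\mathfrak{B}_+,\mathfrak{B}_-\in\mathfrak{L}^{\mathtt w}_{cont}$ with $\mathfrak{B}=\mathfrak{B}_+\cap\mathfrak{B}_-$ such that $\mathfrak{B}_+$ is $\Sigma$-dissipative and $\mathfrak{B}_-$ is $(-\Sigma)$-dissipative. Any such $\mathfrak{B}$ satisfies $\mathtt m(\mathfrak{B})\leqslant\min(\sigma_+(\Sigma),\sigma_-(\Sigma))$. In case $\mathfrak{B}$ is uncontrollable, $\mathtt m(\mathfrak{B})<\min(\sigma_+(\Sigma),\sigma_-(\Sigma))$. If $\mathtt m(\mathfrak{B})\geqslant1$, then neither $\mathfrak{B}_+$ nor $\mathfrak{B}_-$ can be strictly dissipative (with respect to $\Sigma$ and $-\Sigma$, respectively).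
   Context: A linear differential behavior with $\mathtt w$ variables is a set $\mathfrak{B}=\{w\in C^\infty(\mathbb{R},\mathbb{R}^{\mathtt w}) : R(\frac{d}{dt})w=0\}$ for some polynomial matrix $R(\xi)$ with real coefficients and $\mathtt w$ columns. $\mathfrak{L}^{\mathtt w}$ is the set of all such behaviors. The input cardinality is $\mathtt m(\mathfrak{B}):=\mathtt w-\operatorname{rank}R$ (rank as a polynomial matrix). $\mathfrak{B}$ is controllable if for all $w_1,w_2\in\mathfrak{B}$ there exist $w_3\in\mathfrak{B}$ and $\tau>0$ with $w_3(t)=w_1(t)$ for $t\le 0$ and $w_3(t)=w_2(t)$ for $t\ge\tau$; otherwise it is uncontrollable. $\mathfrak{L}^{\mathtt w}_{cont}$ is the set of controllable behaviors in $\mathfrak{L}^{\mathtt w}$, and $\mathfrak{D}$ is the set of compactly supported functions in $C^\infty(\mathbb{R},\mathbb{R}^{\mathtt w})$. $\sigma_+(\Sigma)$ and $\sigma_-(\Sigma)$ are the numbers of positive and negative eigenvalues of $\Sigma$. For symmetric nonsingular $S\in\mathbb{R}^{\mathtt w\times\mathtt w}$, a behavior $\mathfrak{B}$ is $S$-dissipative if there is $\Psi=\sum_{j,k}\Psi_{jk}\zeta^j\eta^k\in\mathbb{R}^{\mathtt w\times\mathtt w}[\zeta,\eta]$ such that $Q_\Psi(w)=\sum_{j,k}(\frac{d^jw}{dt^j})^T\Psi_{jk}\frac{d^kw}{dt^k}$ satisfies $\frac{d}{dt}Q_\Psi(w)\leqslant w^TSw$ for all $w\in\mathfrak{B}$;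 for controllable $\mathfrak{B}$ this is equivalent to $\int_{\mathbb{R}}w^TSw\,dt\geqslant0$ for all $w\in\mathfrak{B}\cap\mathfrak{D}$. A controllable behavior $\mathfrak{B}$ is strictly $S$-dissipative if there is $\epsilon>0$ with $\int_{\mathbb{R}}w^TSw\,dt\geqslant\epsilon\int_{\mathbb{R}}\|w\|^2dt$ for all $w\in\mathfrak{B}\cap\mathfrak{D}$. *)

theory Defs
  imports
    "HOL-Analysis.Analysis"
    "HOL-Computational_Algebra.Computational_Algebra"
begin

type_synonym 'w traj = "real \<Rightarrow> real ^ 'w"

definition nderiv :: "nat \<Rightarrow> (real \<Rightarrow> 'a::real_normed_vector) \<Rightarrow> real \<Rightarrow> 'a" where
  "nderiv k w = ((\<lambda>f t. vector_derivative f (at t)) ^^ k) w"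

definition smooth :: "(real \<Rightarrow> 'a::real_normed_vector) \<Rightarrow> bool" where
  "smooth w \<longleftrightarrow> (\<forall>k t. nderiv k w differentiable (at t))"

definition compactly_supported :: "'w::finite traj set" where
  "compactly_supported = {w. smooth w \<and> compact (closure {t. w t \<noteq> 0})}"

text \<open>
  A polynomial matrix with columns indexed by \<open>'w\<close> and an arbitrary (not type-level) number of
  rows is given by the list of its rows.
\<close>

type_synonym 'w pmatrix = "(real poly ^ 'w) list"

definition row_diff_op :: "real poly ^ 'w::finite \<Rightarrow> 'w traj \<Rightarrow> real \<Rightarrow> real" where
  "row_diff_op r w t = (\<Sum>j\<in>UNIV. \<Sum>i\<le>degree (r $ j). coeff (r $ j) i * nderiv i w t $ j)"

definition kernel_behavior :: "'w::finite pmatrix \<Rightarrow> 'w traj set" where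
  "kernel_behavior R = {w. smooth w \<and> (\<forall>r\<in>set R. \<forall>t. row_diff_op r w t = 0)}"

definition behaviors :: "'w::finite traj set set" where
  "behaviors = range kernel_behavior"

text \<open>
  The rank of a polynomial matrix is its rank over the field of rational functions. As in
  the library definition of \<^const>\<open>rank\<close>, this is the dimension of the span of the rows.
\<close>

definition pmatrix_rank :: "'w::finite pmatrix \<Rightarrow> nat" where
  "pmatrix_rank R = vec.dim ((\<lambda>r. \<chi> j. to_fract (r $ j)) ` set R)"

text \<open>All kernel representations of a behavior have the same rank, so the choice is immaterial.\<close>

definition input_cardinality :: "'w::finite traj set \<Rightarrow> nat" where
  "input_cardinality B = CARD('w) - pmatrix_rank (SOME R. kernel_behavior R = B)"

definition controllable :: "'w::finite traj set \<Rightarrow> bool" where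
  "controllable B \<longleftrightarrow>
     (\<forall>w1\<in>B. \<forall>w2\<in>B. \<exists>w3\<in>B. \<exists>\<tau>>0. (\<forall>t\<le>0. w3 t = w1 t) \<and> (\<forall>t\<ge>\<tau>. w3 t = w2 t))"

definition controllable_behaviors :: "'w::finite traj set set" where
  "controllable_behaviors = {B \<in> behaviors. controllable B}"

text \<open>
  A two-variable polynomial matrix in \<open>\<zeta>\<close>, \<open>\<eta>\<close> is a polynomial in \<open>\<zeta>\<close> whose coefficients are
  polynomials in \<open>\<eta>\<close> with matrix coefficients; \<open>coeff (coeff \<Psi> j) k\<close> is the coefficient of
  \<open>\<zeta>\<^sup>j \<eta>\<^sup>k\<close>.
\<close>

definition qdf :: "(real ^ 'w ^ 'w) poly poly \<Rightarrow> 'w::finite traj \<Rightarrow> real \<Rightarrow> real" where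
  "qdf \<Psi> w t = (\<Sum>j\<le>degree \<Psi>. \<Sum>k\<le>degree (coeff \<Psi> j).
      nderiv j w t \<bullet> (coeff (coeff \<Psi> j) k *v nderiv k w t))"

definition dissipative :: "real ^ 'w ^ 'w \<Rightarrow> 'w::finite traj set \<Rightarrow> bool" where
  "dissipative S B \<longleftrightarrow> (\<exists>\<Psi>. \<forall>w\<in>B. \<forall>t. deriv (qdf \<Psi> w) t \<le> w t \<bullet> (S *v w t))"

text \<open>Strict dissipativity is meant for controllable behaviors only.\<close>

definition strictly_dissipative :: "real ^ 'w ^ 'w \<Rightarrow> 'w::finite traj set \<Rightarrow> bool" where
  "strictly_dissipative S B \<longleftrightarrow> (\<exists>\<epsilon>>0. \<forall>w \<in> B \<inter> compactly_supported.
      integral UNIV (\<lambda>t. w t \<bullet> (S *v w t)) \<ge> \<epsilon> * integral UNIV (\<lambda>t. (norm (w t))\<^sup>2))"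

definition charpoly :: "real ^ 'w ^ 'w \<Rightarrow> real poly" where
  "charpoly A = det (\<chi> i j. (if i = j then [:0, 1:] else 0) - [:A $ i $ j:])"

text \<open>Eigenvalues are counted with (algebraic) multiplicity.\<close>

definition sigma_pos :: "real ^ 'w ^ 'w \<Rightarrow> nat" where
  "sigma_pos A = (\<Sum>x \<in> {x. x > 0 \<and> poly (charpoly A) x = 0}. order x (charpoly A))"

definition sigma_neg :: "real ^ 'w ^ 'w \<Rightarrow> nat" where
  "sigma_neg A = (\<Sum>x \<in> {x. x < 0 \<and> poly (charpoly A) x = 0}. order x (charpoly A))"

definition indefinite :: "real ^ 'w ^ 'w \<Rightarrow> bool" where
  "indefinite A \<longleftrightarrow> (\<exists>x. x \<bullet> (A *v x) > 0) \<and> (\<exists>x. x \<bullet> (A *v x) < 0)"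

definition dissipative_decomposition ::
    "real ^ 'w ^ 'w \<Rightarrow> 'w::finite traj set \<Rightarrow> 'w traj set \<Rightarrow> 'w traj set \<Rightarrow> bool" where
  "dissipative_decomposition S B Bp Bm \<longleftrightarrow>
     Bp \<in> controllable_behaviors \<and> Bm \<in> controllable_behaviors \<and> B = Bp \<inter> Bm \<and>
     dissipative S Bp \<and> dissipative (- S) Bm"

end

theory Submission
  imports Defs
begin

text \<open>
  Constant trajectories have a constant storage function, so \<open>x\<^sup>T S x \<ge> 0\<close> on the real kernel of \<open>R(0)\<close>,
  whose dimension is at least the input cardinality; this bounds the input cardinality of an
  \<open>S\<close>-dissipative behavior by the number of positive eigenvalues of \<open>S\<close>. If equality holds for
  \<open>B\<close>, then \<open>B\<close> has as many inputs as the controllable behavior \<open>B\<^sub>+\<close> containing it. The rows of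
  both kernel representations then span the same rational space, and since every trajectory of
  \<open>B\<^sub>+\<close> can be steered to rest, \<open>B = B\<^sub>+\<close>. Finally, a behavior with an input contains a nonzero
  compactly supported trajectory, built from a polynomial kernel vector and a bump function, on
  which both dissipation inequalities force \<open>\<integral> w\<^sup>T S w = 0\<close>.
\<close>

section \<open>Scalar differential operators\<close>

text \<open>Existence is witnessed by the zero behavior; the substance lies in the bounds. R(0) is
  enough for the dimension bound because evaluating a polynomial matrix at a point can only lower
  its rank, so the real kernel can only grow. The obstacle in the strict bound is that equal
  rational row spaces do not give equal kernels: dw/dt = 0 and w = 0 have the same rank. Clearing
  denominators yields q r = sum of polynomial multiples of the rows of the other matrix, so the
  possible gap consists of solutions of q(d/dt) y = 0 with \<open>q\<close> nonzero. Controllability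
  closes it, because such a solution vanishes identically once it is at rest from some time on. The
  same uniqueness fact shows that the bump trajectory is not zero. Every statement about
  \<open>sigma_neg\<close> is the one about \<open>sigma_pos\<close> for - S.\<close>

lemma nderiv_0 [simp]: "nderiv 0 f = f"
  by (simp add: nderiv_def)

lemma nderiv_Suc: "nderiv (Suc k) f t = vector_derivative (nderiv k f) (at t)"
  by (simp add: nderiv_def)

lemma nderiv_nderiv: "nderiv k (nderiv i f) = nderiv (k + i) f"
  by (simp add: nderiv_def funpow_add)

lemma nderiv_Suc2: "nderiv (Suc k) f = nderiv k (nderiv 1 f)"
  by (simp add: nderiv_nderiv)

lemma smooth_has_vector_derivative:
  "smooth f \<Longrightarrow> (nderiv k f has_vector_derivative nderiv (Suc k) f t) (at t)"
  by (simp add: smooth_def nderiv_Suc vector_derivative_works)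

lemma smooth_DERIV:
  fixes f :: "real \<Rightarrow> real"
  shows "smooth f \<Longrightarrow> DERIV (nderiv k f) t :> nderiv (Suc k) f t"
  using smooth_has_vector_derivative[of f k t]
  by (simp add: has_real_derivative_iff_has_vector_derivative)

text \<open>\<open>nderiv\<close> iterates a choice operator that means something only where a
  derivative exists. Exhibiting all candidate derivatives at once settles existence and value
  together; the closure properties below all follow this pattern.\<close>

lemma derivative_sequence_nderiv:
  assumes "F 0 = f" and "\<And>k t. (F k has_vector_derivative F (Suc k) t) (at t)"
  shows "nderiv k f = F k"
proof (induction k)
  case (Suc k)
  have "nderiv (Suc k) f t = F (Suc k) t" for t
    by (simp add: nderiv_Suc Suc vector_derivative_at assms)
  then show ?case by (simp add: fun_eq_iff)
qed (simp add: assms)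

lemma derivative_sequence_smooth:
  assumes "F 0 = f" and "\<And>k t. (F k has_vector_derivative F (Suc k) t) (at t)"
  shows "smooth f"
  unfolding smooth_def derivative_sequence_nderiv[of F, OF assms]
  using assms(2) differentiableI_vector by blast

lemma smooth_nderiv: "smooth f \<Longrightarrow> smooth (nderiv k f)"
  by (rule derivative_sequence_smooth[where F = "\<lambda>i. nderiv (i + k) f"])
    (simp_all add: smooth_has_vector_derivative)

lemma nderiv_const: "nderiv k (\<lambda>t. c) = (\<lambda>t. if k = 0 then c else 0)"
  and smooth_const: "smooth (\<lambda>t. c)"
  using derivative_sequence_nderiv[where F = "\<lambda>k t. if k = 0 then c else 0" and f = "\<lambda>t. c"]
    derivative_sequence_smooth[where F = "\<lambda>k t. if k = 0 then c else 0" and f = "\<lambda>t. c"]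
  by auto

lemma
  assumes "\<And>j. j \<in> J \<Longrightarrow> smooth (f j)"
  shows nderiv_sum: "nderiv k (\<lambda>t. \<Sum>j\<in>J. f j t) = (\<lambda>t. \<Sum>j\<in>J. nderiv k (f j) t)"
    and smooth_sum: "smooth (\<lambda>t. \<Sum>j\<in>J. f j t)"
proof -
  have *: "((\<lambda>t. \<Sum>j\<in>J. nderiv k (f j) t) has_vector_derivative (\<Sum>j\<in>J. nderiv (Suc k) (f j) t)) (at t)"
    for k t
    by (intro has_vector_derivative_sum smooth_has_vector_derivative assms)
  show "nderiv k (\<lambda>t. \<Sum>j\<in>J. f j t) = (\<lambda>t. \<Sum>j\<in>J. nderiv k (f j) t)"
    by (rule derivative_sequence_nderiv[where F = "\<lambda>k t. \<Sum>j\<in>J. nderiv k (f j) t", OF _ *]) simp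
  show "smooth (\<lambda>t. \<Sum>j\<in>J. f j t)"
    by (rule derivative_sequence_smooth[where F = "\<lambda>k t. \<Sum>j\<in>J. nderiv k (f j) t", OF _ *]) simp
qed

lemma
  assumes "bounded_linear L" and "smooth f"
  shows nderiv_linear: "nderiv k (\<lambda>t. L (f t)) = (\<lambda>t. L (nderiv k f t))"
    and smooth_linear: "smooth (\<lambda>t. L (f t))"
proof -
  have *: "((\<lambda>t. L (nderiv k f t)) has_vector_derivative L (nderiv (Suc k) f t)) (at t)" for k t
    by (rule bounded_linear.has_vector_derivative[OF assms(1) smooth_has_vector_derivative[OF assms(2)]])
  show "nderiv k (\<lambda>t. L (f t)) = (\<lambda>t. L (nderiv k f t))"
    by (rule derivative_sequence_nderiv[where F = "\<lambda>k t. L (nderiv k f t)", OF _ *]) simp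
  show "smooth (\<lambda>t. L (f t))"
    by (rule derivative_sequence_smooth[where F = "\<lambda>k t. L (nderiv k f t)", OF _ *]) simp
qed

lemma nderiv_nth: "smooth w \<Longrightarrow> nderiv k (\<lambda>t. w t $ j) = (\<lambda>t. nderiv k w t $ j)"
  by (rule nderiv_linear[OF bounded_linear_vec_nth])

lemma smooth_nth: "smooth w \<Longrightarrow> smooth (\<lambda>t. w t $ j)"
  by (rule smooth_linear[OF bounded_linear_vec_nth])

lemma smooth_vec_lambda:
  fixes f :: "'w::finite \<Rightarrow> real \<Rightarrow> real"
  assumes "\<And>j. smooth (f j)"
  shows "smooth (\<lambda>t. \<chi> j. f j t)"
proof -
  have "smooth (\<lambda>t. \<Sum>j\<in>UNIV. f j t *\<^sub>R axis j (1::real))"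
    by (intro smooth_sum smooth_linear[where L = "\<lambda>x. x *\<^sub>R axis j 1" for j] assms
        bounded_linear_scaleR_left)
  moreover have "(\<lambda>t. \<Sum>j\<in>UNIV. f j t *\<^sub>R axis j (1::real)) = (\<lambda>t. \<chi> j. f j t)"
    by (simp add: fun_eq_iff vec_eq_iff axis_def if_distrib if_distribR cong: if_cong)
  ultimately show ?thesis by simp
qed

lemma
  assumes "smooth f"
  shows nderiv_shift: "nderiv k (\<lambda>t. f (t + s)) = (\<lambda>t. nderiv k f (t + s))"
    and smooth_shift: "smooth (\<lambda>t. f (t + s))"
proof -
  have *: "((\<lambda>t. nderiv k f (t + s)) has_vector_derivative nderiv (Suc k) f (t + s)) (at t)" for k t
    using vector_diff_chain_at[OF _ smooth_has_vector_derivative[OF assms],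
        of "\<lambda>t. t + s" 1 t k]
    by (simp add: o_def has_vector_derivative_add_const)
  show "nderiv k (\<lambda>t. f (t + s)) = (\<lambda>t. nderiv k f (t + s))"
    by (rule derivative_sequence_nderiv[where F = "\<lambda>k t. nderiv k f (t + s)", OF _ *]) simp
  show "smooth (\<lambda>t. f (t + s))"
    by (rule derivative_sequence_smooth[where F = "\<lambda>k t. nderiv k f (t + s)", OF _ *]) simp
qed

lemma nderiv_cong_open:
  assumes "open U" and "\<And>t. t \<in> U \<Longrightarrow> f t = g t" and "t \<in> U"
  shows "nderiv k f t = nderiv k g t"
  using assms(3)
proof (induction k arbitrary: t)
  case (Suc k)
  have "vector_derivative (nderiv k f) (at t) = vector_derivative (nderiv k g) (at t)"
    by (rule vector_derivative_cong_eq)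
      (use Suc assms(1) eventually_nhds in \<open>auto intro!: exI[of _ U]\<close>)
  then show ?case by (simp add: nderiv_Suc)
qed (simp add: assms)

text \<open>The scalar operator p(d/dt). The lemmas below make the smooth functions a module over
  the real polynomials, with \<open>pdo_mult\<close> as the compatibility of composition and
  product.\<close>

definition pdo :: "real poly \<Rightarrow> (real \<Rightarrow> real) \<Rightarrow> real \<Rightarrow> real" where
  "pdo p f t = (\<Sum>i\<le>degree p. coeff p i * nderiv i f t)"

lemma pdo_eq_sum: "degree p \<le> n \<Longrightarrow> pdo p f t = (\<Sum>i\<le>n. coeff p i * nderiv i f t)"
  unfolding pdo_def by (rule sum.mono_neutral_left) (auto simp: coeff_eq_0)

lemma pdo_0 [simp]: "pdo 0 f t = 0"
  by (simp add: pdo_def)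

lemma pdo_add: "pdo (p + q) f t = pdo p f t + pdo q f t"
  using degree_add_le_max[of p q]
  by (simp add: pdo_eq_sum[of _ "max (degree p) (degree q)"] algebra_simps sum.distrib)

lemma pdo_smult: "pdo (smult a p) f t = a * pdo p f t"
  by (simp add: pdo_eq_sum[of _ "degree p"] sum_distrib_left mult.assoc)

lemma pdo_pCons: "pdo (pCons a p) f t = a * f t + pdo p (nderiv 1 f) t"
proof -
  have "pdo (pCons a p) f t = (\<Sum>i\<le>Suc (degree p). coeff (pCons a p) i * nderiv i f t)"
    by (rule pdo_eq_sum) (simp add: degree_pCons_le)
  also have "\<dots> = a * f t + (\<Sum>i\<le>degree p. coeff p i * nderiv i (nderiv 1 f) t)"
    by (simp only: sum.atMost_Suc_shift coeff_pCons_0 coeff_pCons_Suc nderiv_0 nderiv_Suc2)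
  finally show ?thesis by (simp add: pdo_def)
qed

lemma pdo_sum_poly: "pdo (\<Sum>i\<in>I. p i) f t = (\<Sum>i\<in>I. pdo (p i) f t)"
  by (induction I rule: infinite_finite_induct) (simp_all add: pdo_add)

lemma
  assumes "smooth f"
  shows smooth_pdo: "smooth (pdo p f)"
    and nderiv_pdo: "nderiv k (pdo p f) = pdo p (nderiv k f)"
proof -
  have eq: "pdo p f = (\<lambda>t. \<Sum>i\<le>degree p. coeff p i * nderiv i f t)"
    by (simp add: fun_eq_iff pdo_def)
  have sm: "smooth (\<lambda>t. coeff p i * nderiv i f t)" for i
    by (rule smooth_linear[OF bounded_linear_mult_right smooth_nderiv[OF assms]])
  show "smooth (pdo p f)"
    unfolding eq by (rule smooth_sum[OF sm])
  have comm: "nderiv k (nderiv i f) = nderiv i (nderiv k f)" for i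
    by (simp add: nderiv_nderiv add.commute)
  show "nderiv k (pdo p f) = pdo p (nderiv k f)"
    unfolding eq nderiv_sum[OF sm]
    by (simp add: fun_eq_iff pdo_def comm
        nderiv_linear[OF bounded_linear_mult_right smooth_nderiv[OF assms]])
qed

lemma pdo_mult: "smooth f \<Longrightarrow> pdo (p * q) f t = pdo p (pdo q f) t"
proof (induction p arbitrary: f)
  case (pCons a p)
  have "pdo (p * q) (nderiv 1 f) t = pdo p (nderiv 1 (pdo q f)) t"
    using pCons.IH[OF smooth_nderiv[OF pCons.prems]] nderiv_pdo[OF pCons.prems] by metis
  then show ?case
    by (simp add: mult_pCons_left pdo_add pdo_smult pdo_pCons)
qed simp

lemma pdo_sum_fun:
  assumes "\<And>j. j \<in> J \<Longrightarrow> smooth (f j)"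
  shows "pdo p (\<lambda>t. \<Sum>j\<in>J. f j t) t = (\<Sum>j\<in>J. pdo p (f j) t)"
  unfolding pdo_def by (subst sum.swap) (simp add: nderiv_sum[OF assms] sum_distrib_left)

lemma pdo_zero_fun [simp]: "pdo p (\<lambda>t. 0) t = 0"
  by (simp add: pdo_def nderiv_const)

lemma row_diff_op_eq_pdo:
  "smooth w \<Longrightarrow> row_diff_op r w t = (\<Sum>j\<in>UNIV. pdo (r $ j) (\<lambda>t. w t $ j) t)"
  by (simp add: row_diff_op_def pdo_def nderiv_nth)

text \<open>The energy \<open>\<Sum>i<n. y\<^sup>(\<^sup>i\<^sup>)\<^sup>2\<close> of a solution satisfies \<open>E' \<ge> - C E\<close>, so \<open>E t * exp (C * t)\<close> increases
  and is squeezed to \<open>0\<close> to the left of the final rest interval.\<close>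

lemma pdo_eq_0_imp_zero:
  assumes "smooth y" and "q \<noteq> 0" and eq: "\<And>t. pdo q y t = 0" and rest: "\<And>t. t \<ge> T \<Longrightarrow> y t = 0"
  shows "y t = 0"
\<comment> \<open>In degree 0 the energy would be an empty sum and say nothing about
  \<open>y\<close>; there the operator is multiplication by a nonzero constant.\<close>
proof (cases "degree q = 0")
  case True
  then show ?thesis
    using eq[of t] \<open>q \<noteq> 0\<close> by (auto simp: pdo_def elim!: degree_eq_zeroE)
next
  case False
  define n where "n = degree q"
  have n: "n > 0" using False by (simp add: n_def)
  define E where "E = (\<lambda>t. \<Sum>i<n. (nderiv i y t)\<^sup>2)"
  define A where "A = (\<Sum>i<n. \<bar>coeff q i / lead_coeff q\<bar>)"
  \<comment> \<open>E' has \<open>n\<close> summands, each at most 2 * sqrt E * ((1 + A) * sqrt E)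
    in absolute value, where \<open>A\<close> controls the highest derivative once the equation is
    solved for it.\<close>
  define C where "C = 2 * real n * (1 + A)"
  have A: "A \<ge> 0" unfolding A_def by (rule sum_nonneg) simp
  have E: "E t \<ge> 0" for t unfolding E_def by (rule sum_nonneg) simp
  have low: "\<bar>nderiv i y t\<bar> \<le> sqrt (E t)" if "i < n" for i t
  proof -
    have "(nderiv i y t)\<^sup>2 \<le> E t"
      unfolding E_def using that by (intro member_le_sum) auto
    then show ?thesis using real_le_rsqrt by fastforce
  qed
  have top: "nderiv n y t = - (\<Sum>i<n. coeff q i / lead_coeff q * nderiv i y t)" for t
  proof -
    have "(\<Sum>i<n. coeff q i * nderiv i y t) + lead_coeff q * nderiv n y t = 0"
      using eq[of t] by (simp add: pdo_def n_def flip: lessThan_Suc_atMost)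
    then show ?thesis
      using \<open>q \<noteq> 0\<close> by (simp add: field_simps flip: sum_divide_distrib)
  qed
  have high: "\<bar>nderiv (Suc i) y t\<bar> \<le> (1 + A) * sqrt (E t)" if "i < n" for i t
  proof (cases "Suc i < n")
    case True
    have "sqrt (E t) \<le> (1 + A) * sqrt (E t)" using mult_right_mono[of 1 "1 + A" "sqrt (E t)"] A E by simp
    then show ?thesis using low[OF True, of t] by linarith
  next
    case False
    then have [simp]: "Suc i = n" using that by simp
    have "\<bar>nderiv n y t\<bar> \<le> (\<Sum>i<n. \<bar>coeff q i / lead_coeff q * nderiv i y t\<bar>)"
      unfolding top abs_minus_cancel by (rule sum_abs)
    also have "\<dots> \<le> (\<Sum>i<n. \<bar>coeff q i / lead_coeff q\<bar> * sqrt (E t))"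
      by (rule sum_mono) (use low in \<open>simp only: abs_mult mult_left_mono lessThan_iff abs_ge_zero\<close>)
    also have "\<dots> = A * sqrt (E t)" by (simp add: A_def sum_distrib_right)
    also have "\<dots> \<le> (1 + A) * sqrt (E t)" using E by (intro mult_right_mono) auto
    finally show ?thesis by simp
  qed
  define E' where "E' = (\<lambda>t. \<Sum>i<n. 2 * nderiv i y t * nderiv (Suc i) y t)"
  have dE: "DERIV E t :> E' t" for t
    unfolding E_def E'_def
    by (rule DERIV_sum) (auto intro!: derivative_eq_intros smooth_DERIV[OF assms(1)])
  have bound: "E' t \<ge> - C * E t" for t
  proof -
    have "\<bar>E' t\<bar> \<le> (\<Sum>i<n. \<bar>2 * nderiv i y t * nderiv (Suc i) y t\<bar>)"
      unfolding E'_def by (rule sum_abs)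
    also have "\<dots> \<le> (\<Sum>i<n. 2 * (sqrt (E t) * ((1 + A) * sqrt (E t))))"
      by (rule sum_mono) (use low high E A in \<open>auto simp: abs_mult mult.assoc intro!: mult_mono\<close>)
    also have "\<dots> = C * E t" using E[of t] by (simp add: C_def algebra_simps)
    finally show ?thesis by linarith
  qed
  \<comment> \<open>The rest region contains a whole neighbourhood of \<open>s\<close> only for s >
    T; this is why the comparison point below is \<open>T + 1\<close>.\<close>
  have E0: "E s = 0" if "s > T" for s
  proof -
    have "nderiv i y s = nderiv i (\<lambda>t. 0) s" for i
      by (rule nderiv_cong_open[of "{T<..}"]) (use that rest in auto)
    then show ?thesis by (simp add: E_def nderiv_const)
  qed
  show ?thesis
  proof (cases "t \<ge> T")
    case False
    have "E t * exp (C * t) \<le> E (T + 1) * exp (C * (T + 1))"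
    proof (rule DERIV_nonneg_imp_nondecreasing[where f = "\<lambda>t. E t * exp (C * t)"])
      fix x
      have "DERIV (\<lambda>t. E t * exp (C * t)) x :> (E' x + C * E x) * exp (C * x)"
        by (auto intro!: derivative_eq_intros dE simp: algebra_simps)
      moreover have "(E' x + C * E x) * exp (C * x) \<ge> 0" using bound[of x] by simp
      ultimately show "\<exists>y. DERIV (\<lambda>t. E t * exp (C * t)) x :> y \<and> y \<ge> 0" by blast
    qed (use False in simp)
    then have "E t \<le> 0" by (simp add: E0 mult_le_0_iff)
    then show ?thesis using low[OF n, of t] E[of t] by simp
  qed (simp add: rest)
qed

section \<open>A smooth bump function\<close>

text \<open>With \<open>u = 1 / (t (1 - t))\<close>, the functions \<open>P(t) u\<^sup>n e\<^sup>-\<^sup>u\<close> on \<open>(0,1)\<close>, extended by zero, are closed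
  under differentiation; at the end points they are quadratically small.\<close>

definition bump_term :: "real poly \<Rightarrow> nat \<Rightarrow> real \<Rightarrow> real" where
  "bump_term P n t = (if 0 < t \<and> t < 1 then poly P t * (1 / (t * (1 - t))) ^ n * exp (- (1 / (t * (1 - t)))) else 0)"

text \<open>With v = t (1 - t), which is \<open>[:0, 1, -1:]\<close>, and u = 1/v one has u' = - (1
  - 2 t) u^2. Taking u^(n+2) exp(-u) out of the derivative of P u^n exp(-u) leaves P' v^2 + P (1 - 2
  t) (1 - n v).\<close>

definition bump_poly :: "real poly \<Rightarrow> nat \<Rightarrow> real poly" where
  "bump_poly P n = pderiv P * [:0, 1, -1:]\<^sup>2 + P * [:1, -2:] * ([:1:] - smult (real n) [:0, 1, -1:])"

text \<open>u^n / n! is a single term of the nonnegative series of exp u.\<close>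

lemma power_exp_minus_le: "u \<ge> 0 \<Longrightarrow> u ^ n * exp (- u) \<le> fact n" for u :: real
proof -
  assume u: "u \<ge> 0"
  have "(\<Sum>k\<in>{n}. u ^ k /\<^sub>R fact k) \<le> exp u"
    unfolding exp_def by (rule sum_le_suminf) (use u summable_exp_generic[of u] in auto)
  then show ?thesis by (simp add: exp_minus field_simps)
qed

text \<open>Two extra powers of u = 1/v are paid for by the factor v^2, and
  \<open>power_exp_minus_le\<close> bounds what remains. Quadratic order is what makes the
  derivative vanish at both end points.\<close>

lemma bump_term_bound: "\<exists>C. \<forall>t. \<bar>bump_term P n t\<bar> \<le> C * (t * (1 - t))\<^sup>2"
proof -
  have "bounded (poly P ` {0..1})"
    by (intro compact_imp_bounded compact_continuous_image continuous_intros compact_Icc)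
  then obtain M where "\<And>t. t \<in> {0..1} \<Longrightarrow> \<bar>poly P t\<bar> \<le> M"
    unfolding bounded_iff by (metis imageI real_norm_def)
  then have M: "\<And>t. 0 \<le> t \<Longrightarrow> t \<le> 1 \<Longrightarrow> \<bar>poly P t\<bar> \<le> M" by simp
  have "M \<ge> 0" using M[of 0] by simp
  have "\<bar>bump_term P n t\<bar> \<le> M * fact (n + 2) * (t * (1 - t))\<^sup>2" for t
  proof (cases "0 < t \<and> t < 1")
    case True
    define v where "v = t * (1 - t)"
    have v: "v > 0" using True by (simp add: v_def)
    have "(1 / v) ^ n * exp (- (1 / v)) = (1 / v) ^ (n + 2) * exp (- (1 / v)) * v\<^sup>2"
      using v by (simp add: field_simps power_add power2_eq_square)
    also have "\<dots> \<le> fact (n + 2) * v\<^sup>2"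
      by (intro mult_right_mono power_exp_minus_le) (use v in auto)
    finally have "\<bar>poly P t\<bar> * ((1 / v) ^ n * exp (- (1 / v))) \<le> M * (fact (n + 2) * v\<^sup>2)"
      by (rule mult_mono[rotated]) (use M True v \<open>M \<ge> 0\<close> in simp_all)
    then show ?thesis
      using True v unfolding bump_term_def v_def by (simp add: abs_mult mult.assoc)
  qed (use \<open>M \<ge> 0\<close> in \<open>auto simp: bump_term_def\<close>)
  then show ?thesis by blast
qed

text \<open>The factor \<open>g\<close> takes the zero at the opposite end point, so that one lemma
  serves t = 0 and t = 1.\<close>

lemma DERIV_zero_if_quadratic:
  fixes f :: "real \<Rightarrow> real"
  assumes "\<And>t. \<bar>f t\<bar> \<le> K * (t - a)\<^sup>2 * g t" and "isCont g a"
  shows "DERIV f a :> 0"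
proof -
  have "f a = 0" using assms(1)[of a] by simp
  have "((\<lambda>t. \<bar>K\<bar> * \<bar>t - a\<bar> * \<bar>g t\<bar>) \<longlongrightarrow> \<bar>K\<bar> * \<bar>a - a\<bar> * \<bar>g a\<bar>) (at a)"
    using assms(2) unfolding isCont_def by (intro tendsto_intros)
  then have "((\<lambda>t. \<bar>K\<bar> * \<bar>t - a\<bar> * \<bar>g t\<bar>) \<longlongrightarrow> 0) (at a)" by simp
  moreover have "\<forall>\<^sub>F t in at a. norm ((f t - f a) / (t - a)) \<le> \<bar>K\<bar> * \<bar>t - a\<bar> * \<bar>g t\<bar>"
    unfolding eventually_at_filter
  proof (intro always_eventually allI impI)
    fix t assume "t \<noteq> a"
    have "\<bar>f t\<bar> \<le> \<bar>K * (t - a)\<^sup>2 * g t\<bar>" using assms(1)[of t] by linarith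
    also have "\<dots> = \<bar>K\<bar> * \<bar>t - a\<bar> * \<bar>g t\<bar> * \<bar>t - a\<bar>"
      by (simp add: abs_mult power2_eq_square)
    finally show "norm ((f t - f a) / (t - a)) \<le> \<bar>K\<bar> * \<bar>t - a\<bar> * \<bar>g t\<bar>"
      using \<open>t \<noteq> a\<close> by (simp add: \<open>f a = 0\<close> divide_le_eq)
  qed
  ultimately have "((\<lambda>t. (f t - f a) / (t - a)) \<longlongrightarrow> 0) (at a)"
    by (rule Lim_null_comparison[rotated])
  then show ?thesis by (simp add: has_field_derivative_iff)
qed

lemma DERIV_bump_term: "DERIV (bump_term P n) t :> bump_term (bump_poly P n) (n + 2) t"
proof -
  consider "t < 0 \<or> t > 1" | "t = 0 \<or> t = 1" | "0 < t \<and> t < 1" by linarith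
  then show ?thesis
  proof cases
    case 1
    have "DERIV (bump_term P n) t :> 0 \<longleftrightarrow> DERIV (\<lambda>_. 0::real) t :> 0"
    proof (rule DERIV_cong_ev)
      have "\<forall>\<^sub>F x in nhds t. x \<in> {..<0} \<union> {1<..}"
        using 1 by (intro eventually_nhds_in_open) auto
      then show "\<forall>\<^sub>F x in nhds t. bump_term P n x = 0"
        by eventually_elim (auto simp: bump_term_def)
    qed auto
    then show ?thesis using 1 by (auto simp: bump_term_def)
  next
    case 2
    obtain C where C: "\<And>t. \<bar>bump_term P n t\<bar> \<le> C * (t * (1 - t))\<^sup>2"
      using bump_term_bound by blast
    have "DERIV (bump_term P n) 0 :> 0"
      by (rule DERIV_zero_if_quadratic[where K = C and g = "\<lambda>t. (1 - t)\<^sup>2"])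
        (use C in \<open>auto simp: power_mult_distrib mult.assoc\<close>)
    moreover have "DERIV (bump_term P n) 1 :> 0"
      by (rule DERIV_zero_if_quadratic[where K = C and g = "\<lambda>t. t\<^sup>2"])
        (use C in \<open>auto simp: power_mult_distrib mult_ac power2_commute[of 1]\<close>)
    ultimately show ?thesis using 2 by (auto simp: bump_term_def)
  next
    case 3
    define v where "v = t * (1 - t)"
    have v: "v > 0" using 3 by (simp add: v_def)
    define f where "f = (\<lambda>t. poly P t * (1 / (t * (1 - t))) ^ n * exp (- (1 / (t * (1 - t)))))"
    have du: "DERIV (\<lambda>t. 1 / (t * (1 - t))) t :> - (1 - 2 * t) * (1 / v)\<^sup>2"
      by (rule derivative_eq_intros refl | use 3 in \<open>simp add: v_def divide_simps power2_eq_square\<close>)+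
    have "DERIV f t :> poly (pderiv P) t * (1 / v) ^ n * exp (- (1 / v))
        + poly P t * (real n * (1 / v) ^ (n - 1) * (- (1 - 2 * t) * (1 / v)\<^sup>2)) * exp (- (1 / v))
        + poly P t * (1 / v) ^ n * (exp (- (1 / v)) * - (- (1 - 2 * t) * (1 / v)\<^sup>2))"
      unfolding f_def
      by (rule derivative_eq_intros refl du poly_DERIV)+ (simp add: v_def algebra_simps)
    \<comment> \<open>The truncated \<open>n - 1\<close> is harmless, since the factor
      \<open>real n\<close> is zero when n = 0.\<close>
    also have "real n * (1 / v) ^ (n - 1) * (- (1 - 2 * t) * (1 / v)\<^sup>2) =
        - (1 - 2 * t) * (real n * v) * (1 / v) ^ (n + 2)"
      using v by (cases n) (simp_all add: field_simps power2_eq_square)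
    also have "poly (pderiv P) t * (1 / v) ^ n * exp (- (1 / v))
        + poly P t * (- (1 - 2 * t) * (real n * v) * (1 / v) ^ (n + 2)) * exp (- (1 / v))
        + poly P t * (1 / v) ^ n * (exp (- (1 / v)) * - (- (1 - 2 * t) * (1 / v)\<^sup>2))
        = (poly (pderiv P) t * v\<^sup>2 + poly P t * (1 - 2 * t) * (1 - real n * v))
          * (1 / v) ^ (n + 2) * exp (- (1 / v))"
      using v by (simp add: field_simps power2_eq_square power_add)
    also have "\<dots> = bump_term (bump_poly P n) (n + 2) t"
      using 3 by (simp add: bump_term_def bump_poly_def v_def algebra_simps power2_eq_square)
    finally have "DERIV f t :> bump_term (bump_poly P n) (n + 2) t" .
    moreover have "DERIV (bump_term P n) t :> D \<longleftrightarrow> DERIV f t :> D" for D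
    proof (rule DERIV_cong_ev)
      have "\<forall>\<^sub>F x in nhds t. x \<in> {0<..<1}"
        using 3 by (intro eventually_nhds_in_open) auto
      then show "\<forall>\<^sub>F x in nhds t. bump_term P n x = f x"
        by eventually_elim (simp add: bump_term_def f_def)
    qed auto
    ultimately show ?thesis by simp
  qed
qed

lemma exists_bump:
  obtains \<phi> :: "real \<Rightarrow> real"
  where "smooth \<phi>" and "\<And>t. t \<notin> {0<..<1} \<Longrightarrow> \<phi> t = 0" and "\<phi> (1/2) \<noteq> 0"
proof
  \<comment> \<open>Polynomial and exponent of the k-th derivative, starting from exp(-u), which is
    \<open>bump_term 1 0\<close>.\<close>
  define Q where "Q = (\<lambda>k. ((\<lambda>(P, n). (bump_poly P n, n + 2)) ^^ k) (1, 0))"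
  show "smooth (bump_term 1 0)"
    by (rule derivative_sequence_smooth[where F = "\<lambda>k. bump_term (fst (Q k)) (snd (Q k))"])
      (simp_all add: Q_def case_prod_unfold DERIV_bump_term[simplified]
        flip: has_real_derivative_iff_has_vector_derivative)
qed (auto simp: bump_term_def)

section \<open>The signature of a symmetric matrix\<close>

text \<open>The first-order condition at the minimum t = 0. The trial step - b / s must be short
  enough for the linear term to win; the value there is b^2 / s^2 * (c - 2 s), so any positive s > c
  will do.\<close>

lemma quadratic_nonneg_imp_linear_zero:
  fixes b c :: real
  assumes "\<And>t. 2 * t * b + t\<^sup>2 * c \<ge> 0"
  shows "b = 0"
proof (rule ccontr)
  assume "b \<noteq> 0"
  define s where "s = 1 + \<bar>c\<bar>"
  have s: "s > 0" "c < s" by (auto simp: s_def)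
  have "0 \<le> 2 * (- b / s) * b + (- b / s)\<^sup>2 * c" by (rule assms)
  also have "\<dots> = b\<^sup>2 / s\<^sup>2 * (c - 2 * s)"
    using s by (simp add: field_simps power2_eq_square)
  also have "\<dots> < 0" using s \<open>b \<noteq> 0\<close> by (intro mult_pos_neg) auto
  finally show False by simp
qed

lemma symmetric_matrix_inner:
  fixes A :: "real ^ 'n ^ 'n"
  shows "transpose A = A \<Longrightarrow> (A *v x) \<bullet> y = x \<bullet> (A *v y)"
  by (metis dot_lmul_matrix transpose_matrix_vector)

text \<open>The maximum of the Rayleigh quotient over the unit sphere of the subspace is an eigenvalue.\<close>

lemma symmetric_matrix_eigenvector_in_subspace:
  fixes A :: "real ^ 'n ^ 'n"
  assumes sym: "transpose A = A" and V: "subspace V" and inv: "\<And>x. x \<in> V \<Longrightarrow> A *v x \<in> V"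
    and "V \<noteq> {0}"
  obtains v \<mu> where "v \<in> V" "norm v = 1" "A *v v = \<mu> *\<^sub>R v"
proof -
  define K where "K = sphere 0 1 \<inter> V"
  obtain x where "x \<in> V" "x \<noteq> 0" using \<open>V \<noteq> {0}\<close> subspace_0[OF V] by blast
  then have "x /\<^sub>R norm x \<in> K" by (simp add: K_def V subspace_scale)
  moreover have "compact K"
    unfolding K_def by (intro compact_Int_closed closed_subspace V) simp
  moreover have "continuous_on K (\<lambda>x. x \<bullet> (A *v x))"
    by (intro continuous_intros linear_continuous_on matrix_vector_mul_bounded_linear)
  ultimately obtain v where v: "v \<in> K" and max: "\<And>y. y \<in> K \<Longrightarrow> y \<bullet> (A *v y) \<le> v \<bullet> (A *v v)"
    using continuous_attains_sup[of K "\<lambda>x. x \<bullet> (A *v x)"] by blast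
  define \<mu> where "\<mu> = v \<bullet> (A *v v)"
  have vV: "v \<in> V" and nv: "norm v = 1" using v by (auto simp: K_def)
  have vv: "v \<bullet> v = 1" using nv by (simp add: norm_eq_1)
  have nonneg: "\<mu> * (y \<bullet> y) - y \<bullet> (A *v y) \<ge> 0" if "y \<in> V" for y
  proof (cases "y = 0")
    case False
    define z where "z = y /\<^sub>R norm y"
    have "z \<in> K" using False that by (simp add: z_def K_def V subspace_scale)
    then have "z \<bullet> (A *v z) \<le> \<mu>" using max by (simp add: \<mu>_def)
    moreover have "y = norm y *\<^sub>R z" using False by (simp add: z_def)
    then have "y \<bullet> (A *v y) = (norm y)\<^sup>2 * (z \<bullet> (A *v z))"
      by (metis inner_scaleR_left inner_scaleR_right matrix_vector_mult_scaleR mult.assoc power2_eq_square)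
    ultimately show ?thesis
      by (simp add: power2_norm_eq_inner[symmetric] mult.commute mult_right_mono)
  qed simp
  \<comment> \<open>The form mu |x|^2 - x . A x is nonnegative on \<open>V\<close> and zero at
    \<open>v\<close>. Varying \<open>v\<close> in the direction of the residual \<open>y\<close>,
    which lies in \<open>V\<close> by invariance, gives the linear coefficient y . y, which must
    therefore vanish.\<close>
  define y where "y = \<mu> *\<^sub>R v - A *v v"
  have yV: "y \<in> V" by (simp add: y_def V vV inv subspace_diff subspace_scale)
  have "2 * t * (y \<bullet> y) + t\<^sup>2 * (\<mu> * (y \<bullet> y) - y \<bullet> (A *v y)) \<ge> 0" for t
  proof -
    have "y \<bullet> (A *v v) = v \<bullet> (A *v y)"
      using symmetric_matrix_inner[OF sym, of v y] by (simp add: inner_commute)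
    then have "\<mu> * ((v + t *\<^sub>R y) \<bullet> (v + t *\<^sub>R y)) - (v + t *\<^sub>R y) \<bullet> (A *v (v + t *\<^sub>R y))
      = 2 * t * (\<mu> * (v \<bullet> y) - y \<bullet> (A *v v)) + t\<^sup>2 * (\<mu> * (y \<bullet> y) - y \<bullet> (A *v y))"
      using vv by (simp add: matrix_vector_right_distrib matrix_vector_mult_scaleR inner_add_left
          inner_add_right algebra_simps power2_eq_square \<mu>_def inner_commute[of y v])
    moreover have "y \<bullet> y = \<mu> * (v \<bullet> y) - y \<bullet> (A *v v)"
      by (subst (2) y_def) (simp add: inner_diff_right inner_commute)
    ultimately show ?thesis
      using nonneg[of "v + t *\<^sub>R y"] yV vV V by (simp add: subspace_add subspace_scale)
  qed
  then have "y \<bullet> y = 0" by (rule quadratic_nonneg_imp_linear_zero)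
  then show ?thesis using that[OF vV nv, of \<mu>] by (simp add: y_def)
qed

text \<open>Take an orthonormal set of eigenvectors of maximal size. Its orthogonal complement is
  invariant by symmetry, so a nonzero complement would supply one more eigenvector.\<close>

lemma symmetric_matrix_orthonormal_eigenbasis:
  fixes A :: "real ^ 'n ^ 'n"
  assumes sym: "transpose A = A"
  obtains e :: "'n \<Rightarrow> real ^ 'n" and d :: "'n \<Rightarrow> real"
  where "\<And>i j. e i \<bullet> e j = (if i = j then 1 else 0)" and "\<And>i. A *v e i = d i *\<^sub>R e i"
proof -
  define P where "P = (\<lambda>B::(real ^ 'n) set. pairwise orthogonal B \<and> (\<forall>v\<in>B. norm v = 1 \<and> (\<exists>\<mu>. A *v v = \<mu> *\<^sub>R v)))"
  have ind: "independent B" if "P B" for B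
    using that by (intro pairwise_orthogonal_independent) (auto simp: P_def)
  have fin: "finite B \<and> card B \<le> CARD('n)" if "P B" for B
    using independent_bound[OF ind[OF that]] by simp
  have "P {}" by (simp add: P_def)
  then obtain B where B: "P B" and max: "\<And>B'. P B' \<Longrightarrow> card B' \<le> card B"
    using ex_has_greatest_nat[of P "{}" card "Suc CARD('n)"] fin by (auto simp: less_Suc_eq_le)
  define V where "V = {y. \<forall>x\<in>B. orthogonal x y}"
  have V: "subspace V" unfolding V_def by (rule subspace_orthogonal_to_vectors)
  have invV: "A *v y \<in> V" if "y \<in> V" for y
    unfolding V_def
  proof (intro CollectI ballI)
    fix x assume "x \<in> B"
    then obtain \<mu> where "A *v x = \<mu> *\<^sub>R x" using B by (auto simp: P_def)
    then have "x \<bullet> (A *v y) = \<mu> * (x \<bullet> y)"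
      using symmetric_matrix_inner[OF sym, of x y] by simp
    also have "x \<bullet> y = 0" using that \<open>x \<in> B\<close> by (simp add: V_def orthogonal_def)
    finally show "orthogonal x (A *v y)" by (simp add: orthogonal_def)
  qed
  have "V = {0}"
  proof (rule ccontr)
    assume "V \<noteq> {0}"
    then obtain v \<mu> where v: "v \<in> V" "norm v = 1" "A *v v = \<mu> *\<^sub>R v"
      using symmetric_matrix_eigenvector_in_subspace[OF sym V invV] by blast
    have "P (insert v B)"
      using B v by (auto simp: P_def V_def pairwise_insert orthogonal_commute)
    then have "card (insert v B) \<le> card B" by (rule max)
    moreover have "v \<notin> B"
      using v by (auto simp: V_def orthogonal_def)
    ultimately show False using fin[OF B] by simp
  qed
  then have "dim {y \<in> UNIV. \<forall>x\<in>span B. orthogonal x y} = 0"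
    unfolding dim_eq_0 V_def using span_base by blast
  then have "dim B = CARD('n)"
    using dim_subspace_orthogonal_to_vectors[of "span B" UNIV] by (simp del: dim_eq_0)
  then have "card B = CARD('n)"
    using dim_eq_card_independent[OF ind[OF B]] by simp
  then obtain e where e: "bij_betw e (UNIV :: 'n set) B"
    using finite_same_card_bij[of "UNIV :: 'n set" B] fin[OF B] by auto
  have eB: "e i \<in> B" for i using e by (auto simp: bij_betw_def)
  have "\<exists>\<mu>. A *v e i = \<mu> *\<^sub>R e i" for i
    using eB[of i] B by (auto simp: P_def)
  then obtain d where d: "\<And>i. A *v e i = d i *\<^sub>R e i" by metis
  have "e i \<bullet> e j = (if i = j then 1 else 0)" for i j
  proof (cases "i = j")
    case True
    then show ?thesis using eB[of j] B by (auto simp: P_def norm_eq_1)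
  next
    case False
    then have "e i \<noteq> e j" using e by (auto simp: bij_betw_def inj_on_def)
    then show ?thesis using eB B False by (auto simp: P_def pairwise_def orthogonal_def)
  qed
  then show ?thesis using that d by blast
qed

lemma order_prod_linear_factors:
  fixes d :: "'i \<Rightarrow> real"
  assumes "finite I"
  shows "order x (\<Prod>i\<in>I. [:- d i, 1:]) = card {i\<in>I. d i = x}"
  using assms
proof (induction I)
  case (insert i I)
  have "(\<Prod>i\<in>insert i I. [:- d i, 1:]) \<noteq> 0"
    using insert.hyps by (subst prod_zero_iff) auto
  then have "order x (\<Prod>i\<in>insert i I. [:- d i, 1:]) = order x [:- d i, 1:] + card {i\<in>I. d i = x}"
    unfolding prod.insert[OF insert.hyps] by (rule order_mult[THEN trans])
      (simp add: insert.IH)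
  moreover have "{j \<in> insert i I. d j = x} = (if d i = x then insert i {i\<in>I. d i = x} else {i\<in>I. d i = x})"
    by auto
  moreover have "order x [:- d i, 1:] = (if d i = x then 1 else 0)"
    using order_power_n_n[of "d i" 1] by (auto simp: order_0I)
  ultimately show ?case using insert.hyps by simp
qed simp

text \<open>The diagonalisation is lifted to matrices of polynomials: with M the characteristic
  matrix, M P = P D. Orthonormality gives det P nonzero, so it cancels in the integral domain of
  polynomials.\<close>

lemma charpoly_eigenbasis:
  fixes A :: "real ^ 'n ^ 'n" and e :: "'n \<Rightarrow> real ^ 'n"
  assumes orth: "\<And>i j. e i \<bullet> e j = (if i = j then 1 else 0)" and eig: "\<And>i. A *v e i = d i *\<^sub>R e i"
  shows "charpoly A = (\<Prod>i\<in>UNIV. [:- d i, 1:])"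
proof -
  define P :: "real poly ^ 'n ^ 'n" where "P = (\<chi> i j. [:e j $ i:])"
  define M :: "real poly ^ 'n ^ 'n" where "M = (\<chi> i j. (if i = j then [:0, 1:] else 0) - [:A $ i $ j:])"
  define D :: "real poly ^ 'n ^ 'n" where "D = (\<chi> i j. if i = j then [:- d i, 1:] else 0)"
  have const_sum: "(\<Sum>k\<in>UNIV. [:f k:]) = [:\<Sum>k\<in>UNIV. f k:]" for f :: "'n \<Rightarrow> real"
    by (rule poly_eqI) (simp add: coeff_sum coeff_pCons split: nat.split)
  have "transpose P ** P = mat 1"
    using orth by (simp add: vec_eq_iff matrix_matrix_mult_def transpose_def P_def mat_def
        const_sum inner_vec_def one_pCons)
  then have "det (transpose P) * det P = 1"
    by (metis det_I det_mul)
  then have "det P \<noteq> 0" by auto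
  have "M ** P = P ** D"
  proof -
    have "(\<Sum>k\<in>UNIV. M $ i $ k * P $ k $ j) = (\<Sum>k\<in>UNIV. P $ i $ k * D $ k $ j)" for i j
    proof -
      have "(\<Sum>k\<in>UNIV. M $ i $ k * P $ k $ j)
          = (\<Sum>k\<in>UNIV. (if i = k then [:0, 1:] * [:e j $ k:] else 0)) - (\<Sum>k\<in>UNIV. [:A $ i $ k * e j $ k:])"
        unfolding sum_subtractf[symmetric] by (rule sum.cong) (simp_all add: M_def P_def algebra_simps)
      also have "\<dots> = [:0, 1:] * [:e j $ i:] - [:(A *v e j) $ i:]"
        by (simp add: const_sum matrix_vector_mult_def)
      also have "\<dots> = [:e j $ i:] * [:- d j, 1:]"
        by (simp add: eig)
      also have "\<dots> = (\<Sum>k\<in>UNIV. P $ i $ k * D $ k $ j)"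
        by (simp add: P_def D_def if_distrib cong: if_cong)
      finally show ?thesis .
    qed
    then show ?thesis by (simp add: vec_eq_iff matrix_matrix_mult_def)
  qed
  then have "det M * det P = det P * det D"
    by (metis det_mul)
  then have "det M = det D" using \<open>det P \<noteq> 0\<close> by simp
  moreover have "det D = (\<Prod>i\<in>UNIV. [:- d i, 1:])"
    by (subst det_diagonal) (simp_all add: D_def)
  ultimately show ?thesis by (simp add: charpoly_def M_def)
qed

text \<open>The fibres of \<open>d\<close> partition the indices, and each has the multiplicity of
  its eigenvalue as its size. The predicate \<open>Q\<close> covers both signs.\<close>

lemma sum_order_roots_eigenbasis:
  fixes A :: "real ^ 'n ^ 'n" and e :: "'n \<Rightarrow> real ^ 'n"
  assumes "\<And>i j. e i \<bullet> e j = (if i = j then 1 else 0)" and "\<And>i. A *v e i = d i *\<^sub>R e i"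
  shows "(\<Sum>x \<in> {x. Q x \<and> poly (charpoly A) x = 0}. order x (charpoly A)) = card {i. Q (d i)}"
proof -
  have cp: "charpoly A = (\<Prod>i\<in>UNIV. [:- d i, 1:])" by (rule charpoly_eigenbasis) (fact assms)+
  have roots: "{x. Q x \<and> poly (charpoly A) x = 0} = d ` {i. Q (d i)}"
    by (force simp: cp poly_prod prod_zero_iff)
  have "(\<Sum>x \<in> d ` {i. Q (d i)}. order x (charpoly A)) = (\<Sum>x \<in> d ` {i. Q (d i)}. card {i. d i = x})"
    by (simp add: cp order_prod_linear_factors)
  also have "\<dots> = card (\<Union>x \<in> d ` {i. Q (d i)}. {i. d i = x})"
    by (rule card_UN_disjoint[symmetric]) auto
  also have "(\<Union>x \<in> d ` {i. Q (d i)}. {i. d i = x}) = {i. Q (d i)}" by auto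
  finally show ?thesis by (simp add: roots)
qed

text \<open>The same eigenbasis serves - A with negated eigenvalues. This transfers every bound by
  \<open>sigma_pos\<close> to the other sign.\<close>

lemma sigma_neg_eq_sigma_pos_uminus:
  fixes A :: "real ^ 'n ^ 'n"
  assumes "transpose A = A"
  shows "sigma_neg A = sigma_pos (- A)"
proof -
  obtain e :: "'n \<Rightarrow> real ^ 'n" and d where e: "\<And>i j. e i \<bullet> e j = (if i = j then 1 else 0)" and d: "\<And>i. A *v e i = d i *\<^sub>R e i"
    using symmetric_matrix_orthonormal_eigenbasis[OF assms] by blast
  have "(- A) *v e i = (- d i) *\<^sub>R e i" for i
    using d[of i] by (simp add: vec_eq_iff matrix_vector_mult_def sum_negf)
  from sum_order_roots_eigenbasis[OF e this, of "\<lambda>x. x > 0"]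
    sum_order_roots_eigenbasis[OF e d, of "\<lambda>x. x < 0"]
  show ?thesis by (simp add: sigma_neg_def sigma_pos_def)
qed

text \<open>The form is negative definite on the span \<open>M\<close> of the eigenvectors with
  negative eigenvalues, so \<open>N\<close> meets \<open>M\<close> only in 0 and dim N + dim M is at
  most the full dimension. Invertibility excludes the eigenvalue 0, so the indices left over are the
  positive ones.\<close>

lemma dim_nonneg_subspace_le_sigma_pos:
  fixes A :: "real ^ 'n ^ 'n"
  assumes sym: "transpose A = A" and "invertible A"
    and N: "subspace N" and nonneg: "\<And>x. x \<in> N \<Longrightarrow> x \<bullet> (A *v x) \<ge> 0"
  shows "dim N \<le> sigma_pos A"
proof -
  obtain e :: "'n \<Rightarrow> real ^ 'n" and d where e: "\<And>i j. e i \<bullet> e j = (if i = j then 1 else 0)" and d: "\<And>i. A *v e i = d i *\<^sub>R e i"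
    using symmetric_matrix_orthonormal_eigenbasis[OF sym] by blast
  have inj: "inj e" using e by (metis injI zero_neq_one)
  have d0: "d i \<noteq> 0" for i
  proof
    assume "d i = 0"
    then have "e i = 0"
      using d[of i] \<open>invertible A\<close> by (metis invertible_def matrix_left_invertible_ker scaleR_zero_left)
    then show False using e[of i i] by simp
  qed
  define J where "J = {i. d i < 0}"
  define M where "M = span (e ` J)"
  have "independent (e ` J)"
  proof (rule pairwise_orthogonal_independent)
    show "pairwise orthogonal (e ` J)"
      using e by (auto simp: pairwise_def orthogonal_def)
    show "0 \<notin> e ` J" using e by (metis imageE inner_zero_left zero_neq_one)
  qed
  then have dimM: "dim M = card J"
    unfolding M_def by (simp add: dim_eq_card_independent card_image inj_on_subset[OF inj])
  have neg: "x \<bullet> (A *v x) < 0" if "x \<in> M" "x \<noteq> 0" for x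
  proof -
    from \<open>x \<in> M\<close> obtain c where x: "x = (\<Sum>i\<in>J. c i *\<^sub>R e i)"
      unfolding M_def span_finite[OF finite_imageI[OF finite]]
      by (auto simp: sum.reindex[OF inj_on_subset[OF inj]] o_def)
    have Ax: "A *v x = (\<Sum>i\<in>J. c i *\<^sub>R (d i *\<^sub>R e i))"
      unfolding x by (simp add: vec.sum matrix_vector_mult_scaleR d)
    have "x \<bullet> (A *v x) = (\<Sum>i\<in>J. c i *\<^sub>R e i) \<bullet> (\<Sum>j\<in>J. c j *\<^sub>R (d j *\<^sub>R e j))"
      by (simp only: Ax) (simp only: x)
    also have "\<dots> = (\<Sum>i\<in>J. \<Sum>j\<in>J. (c i *\<^sub>R e i) \<bullet> (c j *\<^sub>R (d j *\<^sub>R e j)))"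
      by (simp only: inner_sum_left inner_sum_right) (rule sum.swap)
    also have "\<dots> = (\<Sum>i\<in>J. \<Sum>j\<in>J. if i = j then c i * (c j * d j) else 0)"
      by (intro sum.cong refl) (simp add: e)
    also have "\<dots> = (\<Sum>i\<in>J. (c i)\<^sup>2 * d i)"
      by (simp add: power2_eq_square mult_ac)
    finally have q: "x \<bullet> (A *v x) = (\<Sum>i\<in>J. (c i)\<^sup>2 * d i)" .
    have "\<exists>i\<in>J. c i \<noteq> 0"
    proof (rule ccontr)
      assume "\<not> (\<exists>i\<in>J. c i \<noteq> 0)"
      then have "x = 0" unfolding x by (intro sum.neutral) simp
      then show False using \<open>x \<noteq> 0\<close> by simp
    qed
    then obtain i where i: "i \<in> J" "c i \<noteq> 0" by blast
    have "(\<Sum>i\<in>J. (c i)\<^sup>2 * d i) < (\<Sum>i\<in>J. 0)"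
    proof (rule sum_strict_mono_ex1)
      show "\<forall>i\<in>J. (c i)\<^sup>2 * d i \<le> 0" by (simp add: J_def mult_nonneg_nonpos)
      show "\<exists>i\<in>J. (c i)\<^sup>2 * d i < 0"
        using i by (intro bexI[of _ i] mult_pos_neg) (simp_all add: J_def)
    qed simp
    then show ?thesis by (simp add: q)
  qed
  have "N \<inter> M = {0}"
    using nonneg neg subspace_0[OF N] by (fastforce simp: M_def span_zero)
  then have "dim N + dim M = dim {x + y |x y. x \<in> N \<and> y \<in> M}"
    using dim_sums_Int[OF N, of M] by (simp add: M_def)
  also have "\<dots> \<le> CARD('n)" using dim_subset_UNIV[of "{x + y |x y. x \<in> N \<and> y \<in> M}"] by simp
  finally have "dim N + card J \<le> CARD('n)" by (simp add: dimM)
  moreover have "card (- J) = CARD('n) - card J" by (simp add: Compl_eq_Diff_UNIV card_Diff_subset)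
  moreover have "card {i. d i > 0} = card (- J)"
  proof -
    have "d i > 0 \<longleftrightarrow> i \<notin> J" for i
      using d0[of i] by (cases "d i" "0::real" rule: linorder_cases) (auto simp: J_def)
    then show ?thesis by (intro arg_cong[of _ _ card]) auto
  qed
  ultimately have "dim N \<le> card {i. d i > 0}" by linarith
  then show ?thesis
    using sum_order_roots_eigenbasis[OF e d, of "\<lambda>x. x > 0"] by (simp add: sigma_pos_def)
qed

section \<open>Polynomial rows over the rational functions\<close>

definition fract_row :: "real poly ^ 'w \<Rightarrow> real poly fract ^ 'w" where
  "fract_row r = (\<chi> j. to_fract (r $ j))"

lemma fract_row_nth [simp]: "fract_row r $ j = to_fract (r $ j)"
  by (simp add: fract_row_def)

lemma pmatrix_rank_fract_row: "pmatrix_rank R = vec.dim (fract_row ` set R)"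
  by (simp add: pmatrix_rank_def fract_row_def[abs_def])

lemma inj_fract_row: "inj fract_row"
  by (rule injI) (simp add: fract_row_def vec_eq_iff)

lemma common_denominator:
  fixes g :: "'i \<Rightarrow> 'a::idom fract"
  assumes "finite I"
  obtains d p where "d \<noteq> 0" and "\<And>i. i \<in> I \<Longrightarrow> to_fract d * g i = to_fract (p i)"
proof -
  have "\<exists>d. d \<noteq> 0 \<and> (\<forall>i\<in>I. \<exists>p. to_fract d * g i = to_fract p)"
    using assms
  proof (induction I)
    case empty
    show ?case by (rule exI[of _ 1]) simp
  next
    case (insert i I)
    then obtain d where d: "d \<noteq> 0" "\<And>i. i \<in> I \<Longrightarrow> \<exists>p. to_fract d * g i = to_fract p" by blast
    obtain a b where ab: "g i = Fract a b" "b \<noteq> 0" by (rule Fract_cases)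
    have "\<exists>p. to_fract (d * b) * g k = to_fract p" if "k \<in> insert i I" for k
    proof (cases "k = i")
      case True
      have "to_fract (d * b) * g i = to_fract (d * a)"
        using ab by (simp add: Fract_conv_to_fract)
      then show ?thesis using True by blast
    next
      case False
      then have "k \<in> I" using that by simp
      then obtain p where "to_fract d * g k = to_fract p" using d(2) by blast
      then have "to_fract (d * b) * g k = to_fract (p * b)" by (simp add: mult_ac)
      then show ?thesis by blast
    qed
    then show ?case using d ab by (intro exI[of _ "d * b"]) simp
  qed
  then show ?thesis using that by metis
qed

text \<open>A basis of the span stays independent when \<open>x\<close> is added, so some
  endomorphism kills the basis and sends \<open>x\<close> to a unit vector. The row of its matrix at
  that coordinate \<open>k\<close>, which is arbitrary, is the functional.\<close>

lemma separating_functional: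
  fixes x :: "'a::field ^ 'n"
  assumes "x \<notin> vec.span A"
  obtains v :: "'a ^ 'n"
  where "\<And>a. a \<in> A \<Longrightarrow> (\<Sum>j\<in>UNIV. a $ j * v $ j) = 0" and "(\<Sum>j\<in>UNIV. x $ j * v $ j) \<noteq> 0"
proof -
  obtain B where B: "B \<subseteq> A" "vec.independent B" "A \<subseteq> vec.span B"
    using vec.maximal_independent_subset[of A] by blast
  have x: "x \<notin> vec.span B" using assms B vec.span_mono by blast
  then have ind: "vec.independent (insert x B)" using B by (simp add: vec.independent_insertI)
  fix k :: 'n
  obtain g where g: "Vector_Spaces.linear (*s) (*s) g"
    and gB: "\<And>y. y \<in> insert x B \<Longrightarrow> g y = (if y = x then axis k 1 else 0 :: 'a ^ 'n)"
    using vec.linear_independent_extend[OF ind, of "\<lambda>y. if y = x then axis k 1 else 0"] by blast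
  define v where "v = (\<chi> j. matrix g $ k $ j)"
  have gv: "g y $ k = (\<Sum>j\<in>UNIV. y $ j * v $ j)" for y
    by (subst matrix_works[OF g, symmetric]) (simp add: v_def matrix_vector_mult_def mult.commute)
  have "g a = 0" if "a \<in> A" for a
  proof (rule vec.linear_eq_0_on_span[OF g])
    show "a \<in> vec.span B" using that B by blast
    show "g y = 0" if "y \<in> B" for y
      using gB[of y] that x vec.span_base by auto
  qed
  moreover have "g x = axis k 1" using gB by simp
  ultimately show ?thesis
    by (intro that[of v]) (simp_all flip: gv)
qed

text \<open>Clearing denominators makes the functional polynomial. It is used both to compare the
  row spaces of two behaviors and to build a compactly supported trajectory.\<close>

lemma polynomial_annihilator:
  fixes A :: "(real poly ^ 'w) set"
  assumes "x \<notin> vec.span (fract_row ` A)"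
  obtains v :: "real poly ^ 'w"
  where "\<And>a. a \<in> A \<Longrightarrow> (\<Sum>j\<in>UNIV. a $ j * v $ j) = 0"
    and "(\<Sum>j\<in>UNIV. x $ j * to_fract (v $ j)) \<noteq> 0"
proof -
  obtain u where u: "\<And>a. a \<in> fract_row ` A \<Longrightarrow> (\<Sum>j\<in>UNIV. a $ j * u $ j) = 0"
    and xu: "(\<Sum>j\<in>UNIV. x $ j * u $ j) \<noteq> 0"
    using separating_functional[OF assms] by metis
  obtain d p where "d \<noteq> 0" and d: "\<And>j. to_fract d * u $ j = to_fract (p j)"
    using common_denominator[of "UNIV :: 'w set" "\<lambda>j. u $ j"] by auto
  have *: "(\<Sum>j\<in>UNIV. y $ j * to_fract (p j)) = to_fract d * (\<Sum>j\<in>UNIV. y $ j * u $ j)" for y :: "real poly fract ^ 'w"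
    by (simp add: d[symmetric] sum_distrib_left mult_ac)
  show ?thesis
  proof (rule that[of "\<chi> j. p j"])
    fix a assume "a \<in> A"
    have "to_fract (\<Sum>j\<in>UNIV. a $ j * p j) = (\<Sum>j\<in>UNIV. fract_row a $ j * to_fract (p j))"
      by simp
    also have "\<dots> = 0" unfolding * using u[of "fract_row a"] \<open>a \<in> A\<close> by simp
    finally have "(\<Sum>j\<in>UNIV. a $ j * p j) = 0" by (simp only: to_fract_eq_0_iff)
    then show "(\<Sum>j\<in>UNIV. a $ j * (\<chi> j. p j) $ j) = 0" by simp
  next
    show "(\<Sum>j\<in>UNIV. x $ j * to_fract ((\<chi> j. p j) $ j)) \<noteq> 0"
      using xu \<open>d \<noteq> 0\<close> by (simp add: *)
  qed
qed

text \<open>\<open>r\<close> itself may fail to be a polynomial combination of the rows, hence the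
  common denominator \<open>q\<close>. It becomes the scalar operator that annihilates the defect of
  a trajectory.\<close>

lemma fract_span_imp_polynomial_combination:
  fixes A :: "(real poly ^ 'w) set"
  assumes "finite A" and "fract_row r \<in> vec.span (fract_row ` A)"
  obtains q :: "real poly" and a :: "real poly ^ 'w \<Rightarrow> real poly"
  where "q \<noteq> 0" and "\<And>j. q * r $ j = (\<Sum>\<rho>\<in>A. a \<rho> * \<rho> $ j)"
proof -
  have inj: "inj_on fract_row A" by (rule inj_on_subset[OF inj_fract_row]) simp
  obtain u where u: "fract_row r = (\<Sum>y\<in>fract_row ` A. u y *s y)"
    using assms by (auto simp: vec.span_finite)
  then have u: "fract_row r = (\<Sum>\<rho>\<in>A. u (fract_row \<rho>) *s fract_row \<rho>)"
    by (simp add: sum.reindex[OF inj])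
  obtain q a where "q \<noteq> 0" and q: "\<And>\<rho>. \<rho> \<in> A \<Longrightarrow> to_fract q * u (fract_row \<rho>) = to_fract (a \<rho>)"
    using common_denominator[OF assms(1), of "\<lambda>\<rho>. u (fract_row \<rho>)"] by metis
  have "to_fract (q * r $ j) = to_fract (\<Sum>\<rho>\<in>A. a \<rho> * \<rho> $ j)" for j
  proof -
    have "to_fract (q * r $ j) = to_fract q * fract_row r $ j" by simp
    also have "\<dots> = (\<Sum>\<rho>\<in>A. to_fract q * u (fract_row \<rho>) * fract_row \<rho> $ j)"
      unfolding u by (simp add: sum_distrib_left mult.assoc del: fract_row_nth)
    also have "\<dots> = to_fract (\<Sum>\<rho>\<in>A. a \<rho> * \<rho> $ j)"
      by (simp add: q)
    finally show ?thesis .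
  qed
  then have "q * r $ j = (\<Sum>\<rho>\<in>A. a \<rho> * \<rho> $ j)" for j by (simp only: to_fract_eq_iff)
  then show ?thesis using that \<open>q \<noteq> 0\<close> by blast
qed

text \<open>Common factors \<open>\<xi>\<close> of all coefficients have to be cancelled before the relation is evaluated at \<open>0\<close>.\<close>

lemma polynomial_relation_at_0:
  fixes a :: "'i \<Rightarrow> real poly" and r :: "'i \<Rightarrow> real poly ^ 'w"
  assumes "finite I" and "\<And>j. (\<Sum>i\<in>I. a i * r i $ j) = 0" and "\<exists>i\<in>I. a i \<noteq> 0"
  shows "\<exists>c. (\<exists>i\<in>I. c i \<noteq> 0) \<and> (\<forall>j. (\<Sum>i\<in>I. c i * poly (r i $ j) 0) = 0)"
  using assms(2,3)
proof (induction "\<Sum>i\<in>I. degree (a i)" arbitrary: a rule: less_induct)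
  case less
  show ?case
  proof (cases "\<exists>i\<in>I. poly (a i) 0 \<noteq> 0")
    case True
    have "(\<Sum>i\<in>I. poly (a i) 0 * poly (r i $ j) 0) = 0" for j
      using arg_cong[OF less.prems(1)[of j], of "\<lambda>p. poly p 0"] by (simp add: poly_sum)
    then show ?thesis using True by (intro exI[of _ "\<lambda>i. poly (a i) 0"]) simp
  next
    case False
    then have "\<forall>i\<in>I. \<exists>b. a i = [:0, 1:] * b"
      using poly_eq_0_iff_dvd[of _ "0::real"] by (auto simp: dvd_def)
    then obtain b where b: "\<And>i. i \<in> I \<Longrightarrow> a i = [:0, 1:] * b i" by metis
    obtain k where k: "k \<in> I" "a k \<noteq> 0" using less.prems(2) by blast
    \<comment> \<open>If \<open>b i = 0\<close> both degrees are 0, so the strict decrease has to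
      come from a nonzero \<open>a k\<close>.\<close>
    have deg: "degree (a i) = (if b i = 0 then 0 else Suc (degree (b i)))" if "i \<in> I" for i
      using b[OF that] by simp
    have "(\<Sum>i\<in>I. degree (b i)) < (\<Sum>i\<in>I. degree (a i))"
    proof (rule sum_strict_mono_ex1[OF assms(1)])
      show "\<forall>i\<in>I. degree (b i) \<le> degree (a i)" by (simp add: deg)
      show "\<exists>i\<in>I. degree (b i) < degree (a i)"
        using k b[OF k(1)] by (intro bexI[of _ k]) (auto simp: deg)
    qed
    moreover have "(\<Sum>i\<in>I. b i * r i $ j) = 0" for j
    proof -
      have "[:0, 1:] * (\<Sum>i\<in>I. b i * r i $ j) = (\<Sum>i\<in>I. a i * r i $ j)"
        unfolding sum_distrib_left by (rule sum.cong[OF refl]) (simp only: b mult.assoc)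
      then show ?thesis using less.prems(1)[of j] by (simp del: mult_pCons_left)
    qed
    moreover have "\<exists>i\<in>I. b i \<noteq> 0" using k b by fastforce
    ultimately show ?thesis by (rule less.hyps)
  qed
qed

text \<open>Rows with independent values at 0 are independent over the rational functions, because a
  rational relation, freed of denominators, specialises to a nontrivial real one.\<close>

lemma dim_eval_rows_le:
  fixes A :: "(real poly ^ 'w) set"
  assumes "finite A"
  shows "dim ((\<lambda>r. \<chi> j. poly (r $ j) 0) ` A) \<le> vec.dim (fract_row ` A)"
proof -
  define ev where "ev = (\<lambda>r::real poly ^ 'w. \<chi> j. poly (r $ j) 0)"
  obtain C where C: "C \<subseteq> ev ` A" "independent C" "card C = dim (ev ` A)"
    using basis_exists[of "ev ` A"] by metis
  \<comment> \<open>One row is kept for each basis vector; injectivity of \<open>ev\<close> on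
    \<open>A'\<close> equates the cardinalities and lets coefficients indexed by rows be moved to
    their values.\<close>
  then obtain A' where A': "A' \<subseteq> A" "inj_on ev A'" "C = ev ` A'"
    by (meson subset_image_inj)
  have fin: "finite A'" using A'(1) assms finite_subset by blast
  have inj: "inj_on fract_row A'" by (rule inj_on_subset[OF inj_fract_row]) simp
  have "vec.independent (fract_row ` A')"
  proof
    assume "vec.dependent (fract_row ` A')"
    then have "\<exists>u. (\<exists>y\<in>fract_row ` A'. u y \<noteq> 0) \<and> (\<Sum>y\<in>fract_row ` A'. u y *s y) = 0"
      by (simp only: vec.dependent_finite[OF finite_imageI[OF fin]])
    then obtain u where nz: "\<exists>\<rho>\<in>A'. u (fract_row \<rho>) \<noteq> 0"
      and u0: "(\<Sum>y\<in>fract_row ` A'. u y *s y) = 0"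
      by blast
    have u: "(\<Sum>\<rho>\<in>A'. u (fract_row \<rho>) *s fract_row \<rho>) = 0"
      using u0 by (simp add: sum.reindex[OF inj])
    obtain d a where "d \<noteq> 0" and d: "\<And>\<rho>. \<rho> \<in> A' \<Longrightarrow> to_fract d * u (fract_row \<rho>) = to_fract (a \<rho>)"
      using common_denominator[OF fin, of "\<lambda>\<rho>. u (fract_row \<rho>)"] by metis
    have "(\<Sum>\<rho>\<in>A'. a \<rho> * \<rho> $ j) = 0" for j
    proof -
      have "to_fract (\<Sum>\<rho>\<in>A'. a \<rho> * \<rho> $ j) = (\<Sum>\<rho>\<in>A'. to_fract d * u (fract_row \<rho>) * fract_row \<rho> $ j)"
        by (simp add: d)
      also have "\<dots> = to_fract d * (\<Sum>\<rho>\<in>A'. u (fract_row \<rho>) *s fract_row \<rho>) $ j"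
        by (simp add: sum_distrib_left mult.assoc del: fract_row_nth)
      also have "\<dots> = 0" by (simp only: u) simp
      finally show ?thesis by (simp only: to_fract_eq_0_iff)
    qed
    moreover have "\<exists>\<rho>\<in>A'. a \<rho> \<noteq> 0"
      using nz d \<open>d \<noteq> 0\<close> by (metis mult_eq_0_iff to_fract_eq_0_iff)
    ultimately obtain c where c: "\<exists>\<rho>\<in>A'. c \<rho> \<noteq> 0" "\<And>j. (\<Sum>\<rho>\<in>A'. c \<rho> * poly (\<rho> $ j) 0) = 0"
      using polynomial_relation_at_0[OF fin, of a "\<lambda>\<rho>. \<rho>"] by blast
    define c' where "c' = (\<lambda>y. c (the_inv_into A' ev y))"
    have c': "c' (ev \<rho>) = c \<rho>" if "\<rho> \<in> A'" for \<rho>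
      using that A'(2) by (simp add: c'_def the_inv_into_f_f)
    have "(\<Sum>y\<in>C. c' y *\<^sub>R y) = (\<Sum>\<rho>\<in>A'. c \<rho> *\<^sub>R ev \<rho>)"
      unfolding A'(3) sum.reindex[OF A'(2)] by (rule sum.cong) (simp_all add: c')
    also have "\<dots> = 0" using c(2) by (simp add: vec_eq_iff ev_def)
    finally have "(\<Sum>y\<in>C. c' y *\<^sub>R y) = 0" .
    moreover have "\<exists>y\<in>C. c' y \<noteq> 0" using c(1) A'(3) c' by auto
    moreover have "finite C" using A'(3) fin by simp
    ultimately have "dependent C" using dependent_finite by blast
    then show False using C(2) by simp
  qed
  then have "card (fract_row ` A') \<le> vec.dim (fract_row ` A)"
    using A'(1) by (intro vec.independent_card_le_dim) auto
  moreover have "card (fract_row ` A') = dim (ev ` A)"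
    using C(3) A' inj by (simp add: card_image)
  ultimately show ?thesis by (simp add: ev_def)
qed

section \<open>Behaviors\<close>

text \<open>Exposes the matrix that \<open>SOME\<close> picks inside
  \<open>input_cardinality\<close>, so that rank arguments can work with it.\<close>

lemma behavior_representation:
  fixes B :: "('w::finite) traj set"
  assumes "B \<in> behaviors"
  obtains R where "kernel_behavior R = B" and "input_cardinality B = CARD('w) - pmatrix_rank R"
proof -
  have "\<exists>R. kernel_behavior R = B" using assms by (auto simp: behaviors_def)
  then have "kernel_behavior (SOME R. kernel_behavior R = B) = B" by (rule someI_ex)
  then show ?thesis using that by (simp add: input_cardinality_def)
qed

lemma pmatrix_rank_le: "pmatrix_rank R \<le> CARD('w)" for R :: "('w::finite) pmatrix"
  unfolding pmatrix_rank_def using vec.dim_subset_UNIV by (metis vec.dimension_def card_cart_basis)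

section \<open>Exponential trajectories and the bound on the input cardinality\<close>

lemma
  fixes x :: "real ^ 'w"
  shows nderiv_exp_trajectory:
      "nderiv k (\<lambda>t. exp (s * t) *\<^sub>R x) = (\<lambda>t. (s ^ k * exp (s * t)) *\<^sub>R x)"
    and smooth_exp_trajectory: "smooth (\<lambda>t. exp (s * t) *\<^sub>R x)"
proof -
  define F where "F = (\<lambda>k t. (s ^ k * exp (s * t)) *\<^sub>R x)"
  have *: "(F k has_vector_derivative F (Suc k) t) (at t)" for k t
    unfolding F_def has_vector_derivative_def
    by (auto intro!: derivative_eq_intros simp: algebra_simps)
  show "nderiv k (\<lambda>t. exp (s * t) *\<^sub>R x) = (\<lambda>t. (s ^ k * exp (s * t)) *\<^sub>R x)"
    using derivative_sequence_nderiv[where F = F, OF _ *] by (simp add: F_def)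
  show "smooth (\<lambda>t. exp (s * t) *\<^sub>R x)"
    using derivative_sequence_smooth[where F = F, OF _ *] by (simp add: F_def)
qed

text \<open>On exp(s t) x the operator R(d/dt) acts as the real matrix R(s). The value s = 0 yields
  the constant trajectories; letting s vary yields polynomial identities.\<close>

lemma exp_trajectory_in_kernel_behavior:
  fixes x :: "real ^ 'w"
  shows "(\<lambda>t. exp (s * t) *\<^sub>R x) \<in> kernel_behavior R \<longleftrightarrow>
    (\<forall>r\<in>set R. (\<Sum>j\<in>UNIV. poly (r $ j) s * x $ j) = 0)"
proof -
  have "row_diff_op r (\<lambda>t. exp (s * t) *\<^sub>R x) t = exp (s * t) * (\<Sum>j\<in>UNIV. poly (r $ j) s * x $ j)" for r t
    unfolding row_diff_op_def nderiv_exp_trajectory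
    by (simp add: poly_altdef sum_distrib_left sum_distrib_right mult_ac)
  then show ?thesis by (simp add: kernel_behavior_def smooth_exp_trajectory)
qed

lemma dissipative_input_cardinality_le:
  fixes S :: "real ^ 'w ^ 'w"
  assumes S: "invertible S" "transpose S = S" and B: "B \<in> behaviors" and diss: "dissipative S B"
  shows "input_cardinality B \<le> sigma_pos S"
proof -
  obtain R where R: "kernel_behavior R = B" and m: "input_cardinality B = CARD('w) - pmatrix_rank R"
    using behavior_representation[OF B] by blast
  obtain \<Psi> where \<Psi>: "\<And>w t. w \<in> B \<Longrightarrow> deriv (qdf \<Psi> w) t \<le> w t \<bullet> (S *v w t)"
    using diss by (auto simp: dissipative_def)
  define A where "A = (\<lambda>r. \<chi> j. poly (r $ j) 0) ` set R"
  \<comment> \<open>The real kernel of R(0), written as an orthogonal complement so that its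
    dimension and that of the row space add up to \<open>CARD('w)\<close>.\<close>
  define N where "N = {x \<in> UNIV. \<forall>a\<in>span A. orthogonal a x}"
  have N: "subspace N" unfolding N_def by (simp add: subspace_orthogonal_to_vectors)
  have "dim N + dim (span A) = CARD('w)"
    unfolding N_def by (subst dim_subspace_orthogonal_to_vectors) simp_all
  moreover have "dim (span A) \<le> pmatrix_rank R"
    using dim_eval_rows_le[of "set R"] by (simp add: A_def pmatrix_rank_fract_row)
  ultimately have "input_cardinality B \<le> dim N" using m by linarith
  also have "dim N \<le> sigma_pos S"
  proof (rule dim_nonneg_subspace_le_sigma_pos[OF S(2,1) N])
    fix x assume "x \<in> N"
    then have "orthogonal (\<chi> j. poly (r $ j) 0) x" if "r \<in> set R" for r
      using that by (simp add: N_def A_def span_base)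
    then have "\<forall>r\<in>set R. (\<Sum>j\<in>UNIV. poly (r $ j) 0 * x $ j) = 0"
      by (simp add: orthogonal_def inner_vec_def)
    then have "(\<lambda>t. x) \<in> B"
      using exp_trajectory_in_kernel_behavior[of 0 x R] R by simp
    from \<Psi>[OF this, of 0] show "0 \<le> x \<bullet> (S *v x)"
      by (simp add: qdf_def[abs_def] nderiv_const)
  qed
  finally show ?thesis .
qed

section \<open>Inclusion of behaviors and their rational row spaces\<close>

lemma annihilator_of_larger_behavior:
  fixes v :: "real poly ^ 'w"
  assumes sub: "kernel_behavior R \<subseteq> kernel_behavior R'"
    and v: "\<And>r. r \<in> set R \<Longrightarrow> (\<Sum>j\<in>UNIV. r $ j * v $ j) = 0" and "r \<in> set R'"
  shows "(\<Sum>j\<in>UNIV. r $ j * v $ j) = 0"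
proof -
  have eval: "(\<Sum>j\<in>UNIV. poly (r $ j) s * (\<chi> j. poly (v $ j) s) $ j) = poly (\<Sum>j\<in>UNIV. r $ j * v $ j) s"
    for r :: "real poly ^ 'w" and s
    by (simp add: poly_sum)
  \<comment> \<open>Since R(s) v(s) = 0 for every real s, each of these exponentials lies in the
    smaller behavior. Membership in the larger one then makes the polynomial r . v vanish at every
    real s.\<close>
  have "(\<lambda>t. exp (s * t) *\<^sub>R (\<chi> j. poly (v $ j) s)) \<in> kernel_behavior R" for s
    unfolding exp_trajectory_in_kernel_behavior eval by (simp add: v)
  then have "poly (\<Sum>j\<in>UNIV. r $ j * v $ j) s = 0" for s
    using sub \<open>r \<in> set R'\<close> exp_trajectory_in_kernel_behavior[of s _ R'] unfolding eval[symmetric] by blast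
  then show ?thesis using poly_all_0_iff_0 by blast
qed

lemma fract_rows_of_larger_behavior:
  fixes R R' :: "('w::finite) pmatrix"
  assumes "kernel_behavior R \<subseteq> kernel_behavior R'"
  shows "fract_row ` set R' \<subseteq> vec.span (fract_row ` set R)"
proof (rule ccontr)
  assume "\<not> ?thesis"
  then obtain r where r: "r \<in> set R'" "fract_row r \<notin> vec.span (fract_row ` set R)" by blast
  obtain v where v: "\<And>a. a \<in> set R \<Longrightarrow> (\<Sum>j\<in>UNIV. a $ j * v $ j) = 0"
    and nz: "(\<Sum>j\<in>UNIV. fract_row r $ j * to_fract (v $ j)) \<noteq> 0"
    using polynomial_annihilator[OF r(2)] by blast
  have "(\<Sum>j\<in>UNIV. fract_row r $ j * to_fract (v $ j)) = to_fract (\<Sum>j\<in>UNIV. r $ j * v $ j)"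
    by (simp add: fract_row_def)
  also have "\<dots> = 0"
    using annihilator_of_larger_behavior[OF assms v r(1)] by simp
  finally show False using nz by simp
qed

lemma row_diff_op_shift:
  "smooth w \<Longrightarrow> row_diff_op r (\<lambda>t. w (t + s)) t = row_diff_op r w (t + s)"
  by (simp add: row_diff_op_def nderiv_shift)

lemma row_diff_op_cong_open:
  assumes "open U" and "\<And>t. t \<in> U \<Longrightarrow> w t = w' t" and "t \<in> U"
  shows "row_diff_op r w t = row_diff_op r w' t"
  unfolding row_diff_op_def by (simp add: nderiv_cong_open[OF assms])

text \<open>For a trajectory \<open>w\<close> that comes to rest, the defect \<open>r(d/dt) w\<close> solves a scalar
  differential equation and comes to rest too, hence vanishes.\<close>

lemma controllable_kernel_behavior_subset:
  fixes R R' :: "('w::finite) pmatrix"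
  assumes sub: "kernel_behavior R \<subseteq> kernel_behavior R'"
    and rank: "pmatrix_rank R \<le> pmatrix_rank R'" and ctr: "controllable (kernel_behavior R')"
  shows "kernel_behavior R' \<subseteq> kernel_behavior R"
proof
  fix w assume w: "w \<in> kernel_behavior R'"
  then have sw: "smooth w" by (simp add: kernel_behavior_def)
  have zero: "row_diff_op r z t = 0"
    if r: "r \<in> set R" and z: "z \<in> kernel_behavior R'" and rest: "\<And>t. t \<ge> \<tau> \<Longrightarrow> z t = 0" for r z \<tau> t
  proof -
    have sz: "smooth z" using z by (simp add: kernel_behavior_def)
    have "fract_row r \<in> vec.span (fract_row ` set R)"
      using r by (simp add: vec.span_base)
    also have "vec.span (fract_row ` set R) = vec.span (vec.span (fract_row ` set R))"
      by (simp add: vec.span_span)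
    \<comment> \<open>The rows of \<open>R'\<close> lie in the span of those of \<open>R\<close>,
      and the rank hypothesis forces equality; the reverse containment is the one that expresses
      \<open>r\<close> through \<open>R'\<close>.\<close>
    also have "\<dots> = vec.span (fract_row ` set R')"
      using rank by (intro vec.dim_eq_span[symmetric] fract_rows_of_larger_behavior[OF sub])
        (simp add: pmatrix_rank_fract_row vec.dim_span)
    finally have "fract_row r \<in> vec.span (fract_row ` set R')" .
    then obtain q a where "q \<noteq> 0" and q: "\<And>j. q * r $ j = (\<Sum>\<rho>\<in>set R'. a \<rho> * \<rho> $ j)"
      by (rule fract_span_imp_polynomial_combination[OF finite_set]) blast
    have sm: "smooth (pdo p (\<lambda>t. z t $ j))" for p j by (intro smooth_pdo smooth_nth sz)
    have row: "row_diff_op \<rho> z = (\<lambda>t. \<Sum>j\<in>UNIV. pdo (\<rho> $ j) (\<lambda>t. z t $ j) t)" for \<rho>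
      by (simp add: fun_eq_iff row_diff_op_eq_pdo[OF sz])
    have comp: "pdo p (row_diff_op \<rho> z) t = (\<Sum>j\<in>UNIV. pdo (p * \<rho> $ j) (\<lambda>t. z t $ j) t)" for p \<rho> t
      unfolding row by (simp add: pdo_sum_fun[OF sm] pdo_mult[OF smooth_nth[OF sz]])
    show ?thesis
    proof (rule pdo_eq_0_imp_zero[where y = "row_diff_op r z" and T = "\<tau> + 1", OF _ \<open>q \<noteq> 0\<close>])
      show "smooth (row_diff_op r z)" unfolding row by (rule smooth_sum[OF sm])
      show "pdo q (row_diff_op r z) t = 0" for t
      proof -
        have "pdo q (row_diff_op r z) t = (\<Sum>j\<in>UNIV. \<Sum>\<rho>\<in>set R'. pdo (a \<rho> * \<rho> $ j) (\<lambda>t. z t $ j) t)"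
          unfolding comp q by (simp add: pdo_sum_poly)
        also have "\<dots> = (\<Sum>\<rho>\<in>set R'. pdo (a \<rho>) (row_diff_op \<rho> z) t)"
          unfolding comp by (rule sum.swap)
        also have "\<dots> = 0"
        proof (intro sum.neutral ballI)
          fix \<rho> assume "\<rho> \<in> set R'"
          then have "row_diff_op \<rho> z = (\<lambda>t. 0)" using z by (auto simp: kernel_behavior_def)
          then show "pdo (a \<rho>) (row_diff_op \<rho> z) t = 0" by simp
        qed
        finally show ?thesis .
      qed
      show "row_diff_op r z t = 0" if "t \<ge> \<tau> + 1" for t
      proof -
        have "row_diff_op r z t = row_diff_op r (\<lambda>t. 0) t"
          by (rule row_diff_op_cong_open[of "{\<tau><..}"]) (use that rest in auto)
        then show ?thesis by (simp add: row_diff_op_def nderiv_const)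
      qed
    qed
  qed
  have "row_diff_op r w t = 0" if r: "r \<in> set R" for r t
  proof -
    \<comment> \<open>The shift moves time \<open>t\<close> to -1, strictly inside the half-line on
      which the steered trajectory agrees with \<open>w1\<close>, so that their derivatives agree
      there as well.\<close>
    define w1 where "w1 = (\<lambda>s. w (s + (t + 1)))"
    have "w1 \<in> kernel_behavior R'"
      using w by (simp add: kernel_behavior_def w1_def smooth_shift row_diff_op_shift)
    moreover have "(\<lambda>t. 0) \<in> kernel_behavior R'"
      by (simp add: kernel_behavior_def smooth_const row_diff_op_def nderiv_const)
    ultimately have "\<exists>z\<in>kernel_behavior R'. \<exists>\<tau>>0. (\<forall>t\<le>0. z t = w1 t) \<and> (\<forall>t\<ge>\<tau>. z t = 0)"
      using bspec[OF bspec[OF ctr[unfolded controllable_def]]] by simp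
    then obtain z \<tau> where z: "z \<in> kernel_behavior R'" "\<And>t. t \<le> 0 \<Longrightarrow> z t = w1 t"
      "\<And>t. t \<ge> \<tau> \<Longrightarrow> z t = 0"
      by auto
    have "row_diff_op r w t = row_diff_op r w1 (- 1)"
      unfolding w1_def row_diff_op_shift[OF sw] by simp
    also have "\<dots> = row_diff_op r z (- 1)"
      by (rule row_diff_op_cong_open[of "{..<0}"]) (auto simp: z(2))
    also have "\<dots> = 0" using zero[OF r z(1,3)] by simp
    finally show ?thesis .
  qed
  then show "w \<in> kernel_behavior R" using sw by (simp add: kernel_behavior_def)
qed

lemma uncontrollable_input_cardinality_less:
  fixes S :: "real ^ 'w ^ 'w"
  assumes S: "invertible S" "transpose S = S" and B: "B \<in> behaviors" "\<not> controllable B"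
    and B': "B' \<in> controllable_behaviors" "dissipative S B'" and sub: "B \<subseteq> B'"
  shows "input_cardinality B < sigma_pos S"
proof (rule ccontr)
  assume "\<not> ?thesis"
  moreover have B'_beh: "B' \<in> behaviors" and ctr: "controllable B'"
    using B'(1) by (auto simp: controllable_behaviors_def)
  moreover have "input_cardinality B' \<le> sigma_pos S"
    by (rule dissipative_input_cardinality_le[OF S B'_beh B'(2)])
  ultimately have le: "input_cardinality B' \<le> input_cardinality B" by simp
  obtain R where R: "kernel_behavior R = B" "input_cardinality B = CARD('w) - pmatrix_rank R"
    using behavior_representation[OF B(1)] by blast
  obtain R' where R': "kernel_behavior R' = B'" "input_cardinality B' = CARD('w) - pmatrix_rank R'"
    using behavior_representation[OF B'_beh] by blast
  \<comment> \<open>Both ranks are at most \<open>CARD('w)\<close>, so the truncated subtractions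
    can be undone.\<close>
  have "pmatrix_rank R \<le> pmatrix_rank R'"
    using le R(2) R'(2) pmatrix_rank_le[of R] pmatrix_rank_le[of R'] by linarith
  then have "B' \<subseteq> B"
    using controllable_kernel_behavior_subset[of R R'] R R' sub ctr by simp
  then have "B = B'" using sub by simp
  then show False using ctr B(2) by simp
qed

section \<open>A nonzero compactly supported trajectory\<close>

lemma compactly_supported_trajectory_exists:
  fixes B :: "('w::finite) traj set"
  assumes "B \<in> behaviors" and "input_cardinality B \<ge> 1"
  obtains w t where "w \<in> B" "w \<in> compactly_supported" "w t \<noteq> 0"
proof -
  obtain R where R: "kernel_behavior R = B" "input_cardinality B = CARD('w) - pmatrix_rank R"
    using behavior_representation[OF assms(1)] by blast
  have "vec.span (fract_row ` set R) \<noteq> UNIV"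
  proof
    assume "vec.span (fract_row ` set R) = UNIV"
    then have "pmatrix_rank R = vec.dim (UNIV :: (real poly fract ^ 'w) set)"
      unfolding pmatrix_rank_fract_row by (metis vec.dim_span)
    then have "pmatrix_rank R = CARD('w)" by (simp add: vec_dim_card card_cart_basis)
    then show False using R assms(2) by simp
  qed
  then obtain x where "x \<notin> vec.span (fract_row ` set R)" by blast
  then obtain v where v: "\<And>r. r \<in> set R \<Longrightarrow> (\<Sum>j\<in>UNIV. r $ j * v $ j) = 0"
    and nz: "(\<Sum>j\<in>UNIV. x $ j * to_fract (v $ j)) \<noteq> 0"
    using polynomial_annihilator by blast
  have "v \<noteq> 0" using nz by auto
  then obtain k where k: "v $ k \<noteq> 0" by (auto simp: vec_eq_iff)
  obtain \<phi> :: "real \<Rightarrow> real" where \<phi>: "smooth \<phi>" "\<And>t. t \<notin> {0<..<1} \<Longrightarrow> \<phi> t = 0" "\<phi> (1/2) \<noteq> 0"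
    using exists_bump by blast
  \<comment> \<open>The image of the bump under v(d/dt): applying a row r gives (r . v)(d/dt) of the
    bump, which is zero because \<open>v\<close> annihilates the rows.\<close>
  define w where "w = (\<lambda>t. \<chi> j. pdo (v $ j) \<phi> t)"
  have sw: "smooth w" unfolding w_def by (intro smooth_vec_lambda smooth_pdo \<phi>(1))
  have "row_diff_op r w t = 0" if "r \<in> set R" for r t
  proof -
    have "row_diff_op r w t = (\<Sum>j\<in>UNIV. pdo (r $ j) (pdo (v $ j) \<phi>) t)"
      unfolding row_diff_op_eq_pdo[OF sw] by (simp add: w_def)
    also have "\<dots> = pdo (\<Sum>j\<in>UNIV. r $ j * v $ j) \<phi> t"
      by (simp add: pdo_sum_poly pdo_mult[OF \<phi>(1)])
    finally show ?thesis by (simp add: v[OF that])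
  qed
  then have "w \<in> B" using sw R(1) by (auto simp: kernel_behavior_def)
  moreover have "w \<in> compactly_supported"
  proof -
    have "pdo p \<phi> t = 0" if "t \<notin> {0..1}" for p t
    proof -
      have "nderiv i \<phi> t = nderiv i (\<lambda>t. 0) t" for i
        by (rule nderiv_cong_open[of "- {0..1}"]) (use \<phi>(2) that in auto)
      then show ?thesis by (simp add: pdo_def nderiv_const)
    qed
    then have "{t. w t \<noteq> 0} \<subseteq> {0..1}"
      by (force simp: w_def vec_eq_iff)
    then have "bounded {t. w t \<noteq> 0}" using bounded_subset bounded_closed_interval by blast
    then show ?thesis using sw by (simp add: compactly_supported_def)
  qed
  moreover have "\<exists>t. w t \<noteq> 0"
  proof (rule ccontr)
    assume "\<not> ?thesis"
    then have "pdo (v $ k) \<phi> t = 0" for t by (simp add: w_def vec_eq_iff)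
    \<comment> \<open>The bump is at rest from time 1 on, so a nonzero operator cannot annihilate it
      unless the bump is identically zero.\<close>
    then have "\<phi> (1/2) = 0"
      using pdo_eq_0_imp_zero[OF \<phi>(1) k, of 1] \<phi>(2) by simp
    then show False using \<phi>(3) by simp
  qed
  ultimately show ?thesis using that by blast
qed

section \<open>Integrals along compactly supported trajectories\<close>

lemma smooth_continuous_on: "smooth f \<Longrightarrow> continuous_on A f"
  unfolding smooth_def
  by (metis nderiv_0 differentiable_imp_continuous_within continuous_at_imp_continuous_on)

lemma compactly_supportedE:
  assumes "w \<in> compactly_supported"
  obtains c where "c > 0" and "\<And>t. t \<notin> {-c..c} \<Longrightarrow> w t = 0"
proof -
  have "bounded {t. w t \<noteq> 0}"
    using assms by (simp add: compactly_supported_def)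
  then obtain c where "c > 0" and c: "\<And>t. w t \<noteq> 0 \<Longrightarrow> \<bar>t\<bar> \<le> c"
    unfolding bounded_pos by auto
  show ?thesis by (rule that[OF \<open>c > 0\<close>]) (use c in fastforce)
qed

lemma integral_UNIV_eq_interval:
  fixes f :: "real \<Rightarrow> real"
  assumes "\<And>t. t \<notin> {a..b} \<Longrightarrow> f t = 0"
  shows "integral UNIV f = integral {a..b} f"
proof -
  have "(\<lambda>t. if t \<in> {a..b} then f t else 0) = f" using assms by auto
  then show ?thesis using integral_restrict_UNIV[of "{a..b}" f] by simp
qed

text \<open>Guarantees that the \<open>deriv\<close> in \<open>dissipative\<close> is a genuine
  derivative, so that the fundamental theorem of calculus applies to the storage function.\<close>

lemma differentiable_qdf:
  assumes "smooth w"
  shows "qdf \<Psi> w differentiable (at t)"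
proof -
  have "(\<lambda>t. nderiv j w t \<bullet> (M *v nderiv k w t)) differentiable (at t)" for j k M
    by (rule differentiableI_vector,
        rule bounded_bilinear.has_vector_derivative[OF bounded_bilinear_inner
          smooth_has_vector_derivative[OF assms]
          bounded_linear.has_vector_derivative[OF matrix_vector_mul_bounded_linear
            smooth_has_vector_derivative[OF assms]]])
  then show ?thesis
    unfolding qdf_def[abs_def] by (intro differentiable_sum ballI) auto
qed

text \<open>Integrating the dissipation inequality over an interval larger than the support leaves
  only boundary values of the storage function, which vanish.\<close>

lemma dissipative_integral_nonneg:
  fixes S :: "real ^ 'w ^ 'w"
  assumes diss: "dissipative S B" and "w \<in> B" and cs: "w \<in> compactly_supported"
  shows "integral UNIV (\<lambda>t. w t \<bullet> (S *v w t)) \<ge> 0"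
proof -
  obtain \<Psi> where \<Psi>: "\<And>t. deriv (qdf \<Psi> w) t \<le> w t \<bullet> (S *v w t)"
    using diss \<open>w \<in> B\<close> by (auto simp: dissipative_def)
  have sw: "smooth w" using cs by (simp add: compactly_supported_def)
  obtain c where "c > 0" and c: "\<And>t. t \<notin> {-c..c} \<Longrightarrow> w t = 0"
    using compactly_supportedE[OF cs] by blast
  \<comment> \<open>The end points must lie strictly outside [-c, c]: there \<open>w\<close> is zero
    on a neighbourhood, and with it all the derivatives that enter \<open>qdf\<close>.\<close>
  define b where "b = c + 1"
  have rest: "qdf \<Psi> w t = 0" if "t \<notin> {-c..c}" for t
  proof -
    have "nderiv i w t = nderiv i (\<lambda>t. 0) t" for i
      by (rule nderiv_cong_open[of "- {-c..c}"]) (use c that in auto)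
    then show ?thesis by (simp add: qdf_def nderiv_const)
  qed
  have "((\<lambda>t. deriv (qdf \<Psi> w) t) has_integral (qdf \<Psi> w b - qdf \<Psi> w (- b))) {-b..b}"
  proof (rule fundamental_theorem_of_calculus)
    show "- b \<le> b" using \<open>c > 0\<close> by (simp add: b_def)
    fix t
    have "DERIV (qdf \<Psi> w) t :> deriv (qdf \<Psi> w) t"
      using differentiable_qdf[OF sw] DERIV_deriv_iff_real_differentiable by blast
    then show "(qdf \<Psi> w has_vector_derivative deriv (qdf \<Psi> w) t) (at t within {-b..b})"
      by (simp add: has_real_derivative_iff_has_vector_derivative has_vector_derivative_at_within)
  qed
  then have 0: "((\<lambda>t. deriv (qdf \<Psi> w) t) has_integral 0) {-b..b}"
    using rest by (simp add: b_def)
  have "continuous_on {-b..b} (\<lambda>t. w t \<bullet> (S *v w t))"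
    by (intro continuous_intros smooth_continuous_on[OF sw]
        bounded_linear.continuous_on[OF matrix_vector_mul_bounded_linear])
  then have "((\<lambda>t. w t \<bullet> (S *v w t)) has_integral integral {-b..b} (\<lambda>t. w t \<bullet> (S *v w t))) {-b..b}"
    by (intro integrable_integral integrable_continuous_real)
  from has_integral_le[OF 0 this] have "0 \<le> integral {-b..b} (\<lambda>t. w t \<bullet> (S *v w t))"
    using \<Psi> by simp
  also have "\<dots> = integral UNIV (\<lambda>t. w t \<bullet> (S *v w t))"
    by (rule integral_UNIV_eq_interval[symmetric]) (use c in \<open>auto simp: b_def\<close>)
  finally show ?thesis .
qed

lemma compactly_supported_integral_norm_pos:
  assumes cs: "w \<in> compactly_supported" and "w s \<noteq> 0"
  shows "integral UNIV (\<lambda>t. (norm (w t))\<^sup>2) > 0"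
proof -
  have sw: "smooth w" using cs by (simp add: compactly_supported_def)
  obtain c where "c > 0" and c: "\<And>t. t \<notin> {-c..c} \<Longrightarrow> w t = 0"
    using compactly_supportedE[OF cs] by blast
  have cont: "continuous_on {-c..c} (\<lambda>t. (norm (w t))\<^sup>2)"
    by (intro continuous_intros smooth_continuous_on[OF sw])
  have s: "s \<in> {-c..c}" using c \<open>w s \<noteq> 0\<close> by blast
  have "integral {-c..c} (\<lambda>t. (norm (w t))\<^sup>2) \<noteq> 0"
  proof
    assume "integral {-c..c} (\<lambda>t. (norm (w t))\<^sup>2) = 0"
    then have "\<forall>t\<in>{-c..c}. (norm (w t))\<^sup>2 = 0"
      using integral_eq_0_iff[OF cont] \<open>c > 0\<close> by simp
    then show False using s \<open>w s \<noteq> 0\<close> by simp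
  qed
  moreover have "integral {-c..c} (\<lambda>t. (norm (w t))\<^sup>2) \<ge> 0"
    by (rule integral_nonneg[OF integrable_continuous_real[OF cont]]) simp
  moreover have "integral UNIV (\<lambda>t. (norm (w t))\<^sup>2) = integral {-c..c} (\<lambda>t. (norm (w t))\<^sup>2)"
    by (rule integral_UNIV_eq_interval) (simp add: c)
  ultimately show ?thesis by simp
qed

lemma uminus_matrix_vector_mult: "(- A) *v x = - (A *v x)" for A :: "real ^ 'n ^ 'm"
  by (simp add: vec_eq_iff matrix_vector_mult_def sum_negf)

text \<open>Along \<open>w\<close>, which lies in both behaviors, the integral of w . S w is at most
  0 by dissipativity for - S, whereas strictness would make it at least a positive multiple of the
  squared norm integral.\<close>

lemma not_strictly_dissipative:
  fixes S :: "real ^ 'w ^ 'w"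
  assumes "w \<in> B" "w \<in> compactly_supported" "w s \<noteq> 0" and "w \<in> B'" "dissipative (- S) B'"
  shows "\<not> strictly_dissipative S B"
proof
  assume "strictly_dissipative S B"
  then obtain \<epsilon> where "\<epsilon> > 0"
    and le: "\<epsilon> * integral UNIV (\<lambda>t. (norm (w t))\<^sup>2) \<le> integral UNIV (\<lambda>t. w t \<bullet> (S *v w t))"
    using assms(1,2) by (auto simp: strictly_dissipative_def)
  have "integral UNIV (\<lambda>t. w t \<bullet> ((- S) *v w t)) \<ge> 0"
    by (rule dissipative_integral_nonneg[OF assms(5,4,2)])
  then have "integral UNIV (\<lambda>t. w t \<bullet> (S *v w t)) \<le> 0"
    by (simp add: uminus_matrix_vector_mult)
  moreover have "\<epsilon> * integral UNIV (\<lambda>t. (norm (w t))\<^sup>2) > 0"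
    using \<open>\<epsilon> > 0\<close> compactly_supported_integral_norm_pos[OF assms(2,3)] by simp
  ultimately show False using le by simp
qed

text \<open>The kernel of the identity matrix, whose rows are the unit vectors; this behavior is the
  witness for existence.\<close>

lemma zero_behavior: "{\<lambda>t. 0} \<in> (behaviors :: ('w::finite) traj set set)"
proof -
  obtain ks :: "'w list" where ks: "set ks = UNIV" using finite_list[of "UNIV :: 'w set"] by auto
  define R :: "'w pmatrix" where "R = map (\<lambda>k. axis k 1) ks"
  have row: "row_diff_op (axis k 1) w t = w t $ k" for k :: 'w and w t
  proof -
    have "(\<Sum>i\<le>degree (axis k 1 $ j :: real poly). coeff (axis k 1 $ j) i * nderiv i w t $ j)
        = (if j = k then w t $ k else 0)" for j
      by (simp add: axis_def)
    then show ?thesis by (simp add: row_diff_op_def)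
  qed
  have "kernel_behavior R = {\<lambda>t. 0}"
    by (auto simp: kernel_behavior_def R_def ks row fun_eq_iff vec_eq_iff smooth_const)
  then show ?thesis unfolding behaviors_def by blast
qed

lemma zero_dissipative_decomposition:
  "dissipative_decomposition S {\<lambda>t. 0} {\<lambda>t. 0} {\<lambda>t. 0}"
proof -
  have "dissipative A {\<lambda>t. 0}" for A :: "real ^ 'w ^ 'w"
    unfolding dissipative_def by (intro exI[of _ 0]) (simp add: qdf_def[abs_def])
  then show ?thesis
    by (auto simp: dissipative_decomposition_def controllable_behaviors_def zero_behavior
        controllable_def intro: exI[of _ 1])
qed

theorem theorem9p5:
  fixes S :: "real ^ 'w ^ 'w"
  assumes "invertible S" and "transpose S = S" and "indefinite S"
  shows "(\<exists>B\<in>behaviors. \<exists>Bp Bm. dissipative_decomposition S B Bp Bm) \<and>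
    (\<forall>B\<in>behaviors. \<forall>Bp Bm. dissipative_decomposition S B Bp Bm \<longrightarrow>
       input_cardinality B \<le> min (sigma_pos S) (sigma_neg S) \<and>
       (\<not> controllable B \<longrightarrow> input_cardinality B < min (sigma_pos S) (sigma_neg S)) \<and>
       (input_cardinality B \<ge> 1 \<longrightarrow>
          \<not> strictly_dissipative S Bp \<and> \<not> strictly_dissipative (- S) Bm))"
proof (intro conjI ballI allI impI)
  show "\<exists>B\<in>behaviors. \<exists>Bp Bm. dissipative_decomposition S B Bp Bm"
    using zero_behavior zero_dissipative_decomposition by blast
next
  fix B Bp Bm :: "'w traj set"
  assume B: "B \<in> behaviors" and dec: "dissipative_decomposition S B Bp Bm"
  then have p: "Bp \<in> controllable_behaviors" "dissipative S Bp" "B \<subseteq> Bp"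
    and m: "Bm \<in> controllable_behaviors" "dissipative (- S) Bm" "B \<subseteq> Bm"
    by (auto simp: dissipative_decomposition_def)
  have inv: "invertible (- S)"
  proof -
    obtain A where "S ** A = mat 1" "A ** S = mat 1"
      using assms(1) by (auto simp: invertible_def)
    then show ?thesis
      unfolding invertible_def
      by (intro exI[of _ "- A"]) (simp add: vec_eq_iff matrix_matrix_mult_def)
  qed
  have sym: "transpose (- S) = - S"
    using assms(2) by (simp add: transpose_def vec_eq_iff)
  have neg: "sigma_neg S = sigma_pos (- S)"
    by (rule sigma_neg_eq_sigma_pos_uminus[OF assms(2)])
  \<comment> \<open>A storage function for a behavior serves every subset, so \<open>B\<close>
    inherits dissipativity for both signs.\<close>
  have "dissipative S B" "dissipative (- S) B"
    using p(2,3) m(2,3) unfolding dissipative_def by blast+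
  then show "input_cardinality B \<le> min (sigma_pos S) (sigma_neg S)"
    using dissipative_input_cardinality_le[OF assms(1,2) B]
      dissipative_input_cardinality_le[OF inv sym B] by (simp add: neg)
  show "input_cardinality B < min (sigma_pos S) (sigma_neg S)" if "\<not> controllable B"
    using uncontrollable_input_cardinality_less[OF assms(1,2) B that p]
      uncontrollable_input_cardinality_less[OF inv sym B that m] by (simp add: neg)
  assume "input_cardinality B \<ge> 1"
  then obtain w t where w: "w \<in> B" "w \<in> compactly_supported" "w t \<noteq> 0"
    using compactly_supported_trajectory_exists[OF B] by blast
  then have "w \<in> Bp" "w \<in> Bm" using p m by auto
  \<comment> \<open>The second claim exchanges the two behaviors and replaces S by - S, using - (-
    S) = S.\<close>
  then show "\<not> strictly_dissipative S Bp" "\<not> strictly_dissipative (- S) Bm"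
    using not_strictly_dissipative[of w Bp t Bm S] not_strictly_dissipative[of w Bm t Bp "- S"] w p m
    by auto
qed

end
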